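(* Let $\Gamma$ be a group and let $A$ be a $\Gamma$-graded ring with graded local units. Then there is an isomorphism of categories $\Psi: A\text{-}\mathrm{Gr}\to (A\#\Gamma)\text{-}\mathrm{Mod}$ such that $\Psi\circ\mathcal{T}_{\alpha}=\widetilde{\mathcal{S}}^{\alpha}\circ\Psi$ for every $\alpha\in\Gamma$, where $\mathcal{T}_\alpha$ is the shift functor on $A\text{-}\mathrm{Gr}$ and $\widetilde{\mathcal S}^\alpha$ is the shift functor on $(A\#\Gamma)\text{-}\mathrm{Mod}$.
   Context: Rings need not have a unit. Let $\Gamma$ be a group with identity $\varepsilon$. A ring $A$ is $\Gamma$-graded if $A=\bigoplus_{\gamma\in\Gamma}A_\gamma$ as additive groups with $A_\gamma A_\delta\subseteq A_{\gamma\delta}$; for $s\in A$ write $s=\sum_\alpha s_\alpha$ with $s_\alpha\in A_\alpha$. $A$ has graded local units if for every finite set $\{x_1,\dots,x_n\}$ of homogeneous elements of $A$ there is a homogeneous idempotent $e\in A$ with $x_1,\dots,x_n\in eAe$. A left module $M$ over a ring $B$ is unital if $BM=M$; $B\text{-}\mathrm{Mod}$ is the category of unital left $B$-modules. $A\text{-}\mathrm{Gr}$ is the category of unital left $A$-modules $M$ equipped with a decomposition $M=\bigoplus_{\gamma}M_\gamma$ with $A_\alpha M_\gamma\subseteq M_{\alpha\gamma}$; morphisms are $A$-module homomorphisms preserving the grading. For $\alpha\in\Gamma$, $\mathcal{T}_\alpha(M)=M(\alpha)$ is $M$ with the grading $M(\alpha)_\gamma=M_{\gamma\alpha}$ (identity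 on morphisms). The smash product $A\#\Gamma$ is the ring of finite formal sums $\sum_{\gamma\in\Gamma}r^{(\gamma)}p_\gamma$ with $r^{(\gamma)}\in A$ and $p_\gamma$ formal symbols, with componentwise addition and multiplication the biadditive extension of $(rp_\alpha)(sp_\beta)=r\,s_{\alpha\beta^{-1}}\,p_\beta$. For $\alpha\in\Gamma$, $\mathcal{S}^\alpha:A\#\Gamma\to A\#\Gamma$ is the automorphism $\mathcal S^\alpha(sp_\beta)=sp_{\beta\alpha}$, and $\widetilde{\mathcal S}^\alpha(M)$ is the abelian group $M$ with action $a\cdot m:=\mathcal S^\alpha(a)m$ (identity on morphisms). *)

theory Defs
  imports "HOL-Algebra.Module" "HOL-Algebra.Generated_Groups"
begin

section \<open>Categories and functors\<close>

text \<open>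
  The hom-sets of a category are indexed by pairs of objects and are not required to be pairwise
  disjoint; hence composition, and the action of a functor on morphisms, take the objects involved
  as arguments.
\<close>

record ('o, 'f) cat =
  Obj :: "'o set"
  Hom :: "'o \<Rightarrow> 'o \<Rightarrow> 'f set"
  Ident :: "'o \<Rightarrow> 'f"
  Comp :: "'o \<Rightarrow> 'o \<Rightarrow> 'o \<Rightarrow> 'f \<Rightarrow> 'f \<Rightarrow> 'f"

locale category =
  fixes C :: "('o, 'f, 'z) cat_scheme"
  assumes ident_hom: "L \<in> Obj C \<Longrightarrow> Ident C L \<in> Hom C L L"
    and comp_hom: "\<lbrakk>L \<in> Obj C; M \<in> Obj C; N \<in> Obj C; f \<in> Hom C L M; g \<in> Hom C M N\<rbrakk>
      \<Longrightarrow> Comp C L M N g f \<in> Hom C L N"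
    and comp_ident_right: "\<lbrakk>L \<in> Obj C; M \<in> Obj C; f \<in> Hom C L M\<rbrakk>
      \<Longrightarrow> Comp C L L M f (Ident C L) = f"
    and comp_ident_left: "\<lbrakk>L \<in> Obj C; M \<in> Obj C; f \<in> Hom C L M\<rbrakk>
      \<Longrightarrow> Comp C L M M (Ident C M) f = f"
    and comp_assoc: "\<lbrakk>K \<in> Obj C; L \<in> Obj C; M \<in> Obj C; N \<in> Obj C;
        f \<in> Hom C K L; g \<in> Hom C L M; h \<in> Hom C M N\<rbrakk>
      \<Longrightarrow> Comp C K L N (Comp C L M N h g) f = Comp C K M N h (Comp C K L M g f)"

record ('o, 'f, 'p, 'h) func =
  fob :: "'o \<Rightarrow> 'p"
  fmor :: "'o \<Rightarrow> 'o \<Rightarrow> 'f \<Rightarrow> 'h"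

definition is_functor ::
  "('o, 'f) cat \<Rightarrow> ('p, 'h) cat \<Rightarrow> ('o, 'f, 'p, 'h) func \<Rightarrow> bool" where
  "is_functor C D F \<longleftrightarrow> category C \<and> category D \<and>
     (\<forall>L\<in>Obj C. fob F L \<in> Obj D) \<and>
     (\<forall>L\<in>Obj C. \<forall>M\<in>Obj C. \<forall>f\<in>Hom C L M. fmor F L M f \<in> Hom D (fob F L) (fob F M)) \<and>
     (\<forall>L\<in>Obj C. fmor F L L (Ident C L) = Ident D (fob F L)) \<and>
     (\<forall>L\<in>Obj C. \<forall>M\<in>Obj C. \<forall>N\<in>Obj C. \<forall>f\<in>Hom C L M. \<forall>g\<in>Hom C M N.
        fmor F L N (Comp C L M N g f)
          = Comp D (fob F L) (fob F M) (fob F N) (fmor F M N g) (fmor F L M f))"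

definition functor_eq ::
  "('o, 'f) cat \<Rightarrow> ('o, 'f, 'p, 'h) func \<Rightarrow> ('o, 'f, 'p, 'h) func \<Rightarrow> bool" where
  "functor_eq C F F' \<longleftrightarrow>
     (\<forall>L\<in>Obj C. fob F L = fob F' L) \<and>
     (\<forall>L\<in>Obj C. \<forall>M\<in>Obj C. \<forall>f\<in>Hom C L M. fmor F L M f = fmor F' L M f)"

definition functor_id :: "('o, 'f, 'o, 'f) func" where
  "functor_id = \<lparr>fob = (\<lambda>L. L), fmor = (\<lambda>L M f. f)\<rparr>"

definition functor_comp ::
  "('p, 'h, 'q, 'k) func \<Rightarrow> ('o, 'f, 'p, 'h) func \<Rightarrow> ('o, 'f, 'q, 'k) func" where
  "functor_comp F' F =
     \<lparr>fob = (\<lambda>L. fob F' (fob F L)),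
      fmor = (\<lambda>L M f. fmor F' (fob F L) (fob F M) (fmor F L M f))\<rparr>"

definition category_iso ::
  "('o, 'f) cat \<Rightarrow> ('p, 'h) cat \<Rightarrow> ('o, 'f, 'p, 'h) func \<Rightarrow> bool" where
  "category_iso C D F \<longleftrightarrow> is_functor C D F \<and>
     (\<exists>F'. is_functor D C F' \<and>
        functor_eq C (functor_comp F' F) functor_id \<and>
        functor_eq D (functor_comp F F') functor_id)"


section \<open>Graded rings\<close>

text \<open>
  Rings without unit are carried by the library's ring records; the field \<open>one\<close> is never used.
\<close>

locale nonunital_ring = abelian_group R for R (structure) +
  assumes m_closed: "\<lbrakk>x \<in> carrier R; y \<in> carrier R\<rbrakk> \<Longrightarrow> x \<otimes> y \<in> carrier R"
    and m_assoc: "\<lbrakk>x \<in> carrier R; y \<in> carrier R; z \<in> carrier R\<rbrakk>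
      \<Longrightarrow> (x \<otimes> y) \<otimes> z = x \<otimes> (y \<otimes> z)"
    and l_distr: "\<lbrakk>x \<in> carrier R; y \<in> carrier R; z \<in> carrier R\<rbrakk>
      \<Longrightarrow> (x \<oplus> y) \<otimes> z = x \<otimes> z \<oplus> y \<otimes> z"
    and r_distr: "\<lbrakk>x \<in> carrier R; y \<in> carrier R; z \<in> carrier R\<rbrakk>
      \<Longrightarrow> z \<otimes> (x \<oplus> y) = z \<otimes> x \<oplus> z \<otimes> y"

definition decomposition ::
  "('m, 'z) ring_scheme \<Rightarrow> 'i set \<Rightarrow> ('i \<Rightarrow> 'm set) \<Rightarrow> 'm \<Rightarrow> ('i \<Rightarrow> 'm) \<Rightarrow> bool" where
  "decomposition H I F x c \<longleftrightarrow> c \<in> (\<Pi>\<^sub>E i\<in>I. F i) \<and> finite {i \<in> I. c i \<noteq> \<zero>\<^bsub>H\<^esub>} \<and>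
     x = (\<Oplus>\<^bsub>H\<^esub>i\<in>{i \<in> I. c i \<noteq> \<zero>\<^bsub>H\<^esub>}. c i)"

definition internal_direct_sum ::
  "('m, 'z) ring_scheme \<Rightarrow> 'i set \<Rightarrow> ('i \<Rightarrow> 'm set) \<Rightarrow> bool" where
  "internal_direct_sum H I F \<longleftrightarrow>
     (\<forall>i\<in>I. subgroup (F i) (add_monoid H)) \<and>
     (\<forall>x\<in>carrier H. \<exists>!c. decomposition H I F x c)"

locale graded_ring = G: group G + A: nonunital_ring A
  for G :: "('g, 'x) monoid_scheme" and A :: "('a, 'y) ring_scheme" +
  fixes \<A> :: "'g \<Rightarrow> 'a set"
  assumes direct_sum: "internal_direct_sum A (carrier G) \<A>"
    and graded_mult: "\<lbrakk>\<gamma> \<in> carrier G; \<delta> \<in> carrier G; x \<in> \<A> \<gamma>; y \<in> \<A> \<delta>\<rbrakk>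
      \<Longrightarrow> x \<otimes>\<^bsub>A\<^esub> y \<in> \<A> (\<gamma> \<otimes>\<^bsub>G\<^esub> \<delta>)"

text \<open>\<open>component G A \<A> s \<alpha>\<close> is the homogeneous component $s_\alpha$ of $s$.\<close>

definition component ::
  "('g, 'x) monoid_scheme \<Rightarrow> ('a, 'y) ring_scheme \<Rightarrow> ('g \<Rightarrow> 'a set) \<Rightarrow> 'a \<Rightarrow> 'g \<Rightarrow> 'a" where
  "component G A \<A> s = (THE c. decomposition A (carrier G) \<A> s c)"

definition homogeneous :: "('g, 'x) monoid_scheme \<Rightarrow> ('g \<Rightarrow> 'a set) \<Rightarrow> 'a set" where
  "homogeneous G \<A> = (\<Union>\<gamma>\<in>carrier G. \<A> \<gamma>)"

definition graded_local_units ::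
  "('g, 'x) monoid_scheme \<Rightarrow> ('a, 'y) ring_scheme \<Rightarrow> ('g \<Rightarrow> 'a set) \<Rightarrow> bool" where
  "graded_local_units G A \<A> \<longleftrightarrow>
     (\<forall>S. finite S \<and> S \<subseteq> homogeneous G \<A> \<longrightarrow>
        (\<exists>e\<in>homogeneous G \<A>. e \<otimes>\<^bsub>A\<^esub> e = e \<and> S \<subseteq> {e \<otimes>\<^bsub>A\<^esub> a \<otimes>\<^bsub>A\<^esub> e |a. a \<in> carrier A}))"


section \<open>The category of unital modules\<close>

locale left_module = B: nonunital_ring B + M: abelian_group M
  for B :: "('b, 'y) ring_scheme" and M :: "('b, 'm, 'z) module_scheme" +
  assumes smult_closed: "\<lbrakk>a \<in> carrier B; x \<in> carrier M\<rbrakk> \<Longrightarrow> a \<odot>\<^bsub>M\<^esub> x \<in> carrier M"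
    and smult_l_distr: "\<lbrakk>a \<in> carrier B; b \<in> carrier B; x \<in> carrier M\<rbrakk>
      \<Longrightarrow> (a \<oplus>\<^bsub>B\<^esub> b) \<odot>\<^bsub>M\<^esub> x = a \<odot>\<^bsub>M\<^esub> x \<oplus>\<^bsub>M\<^esub> b \<odot>\<^bsub>M\<^esub> x"
    and smult_r_distr: "\<lbrakk>a \<in> carrier B; x \<in> carrier M; y \<in> carrier M\<rbrakk>
      \<Longrightarrow> a \<odot>\<^bsub>M\<^esub> (x \<oplus>\<^bsub>M\<^esub> y) = a \<odot>\<^bsub>M\<^esub> x \<oplus>\<^bsub>M\<^esub> a \<odot>\<^bsub>M\<^esub> y"
    and smult_assoc: "\<lbrakk>a \<in> carrier B; b \<in> carrier B; x \<in> carrier M\<rbrakk>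
      \<Longrightarrow> (a \<otimes>\<^bsub>B\<^esub> b) \<odot>\<^bsub>M\<^esub> x = a \<odot>\<^bsub>M\<^esub> (b \<odot>\<^bsub>M\<^esub> x)"

text \<open>$BM = M$, where $BM$ is the additive subgroup generated by the products $bm$.\<close>

locale unital_module = left_module +
  assumes unital: "generate (add_monoid M) {b \<odot>\<^bsub>M\<^esub> x |b x. b \<in> carrier B \<and> x \<in> carrier M} = carrier M"

text \<open>
  Equality of the objects of a module category has to be equality of modules. The module record
  also stores a multiplication and a one on \<open>M\<close>, which a module does not have, and its operations
  are total functions; these superfluous values are fixed once and for all.
\<close>

definition normalized_module :: "('b, 'y) ring_scheme \<Rightarrow> ('b, 'm, 'z) module_scheme \<Rightarrow> bool" where
  "normalized_module B M \<longleftrightarrow>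
     mult M = undefined \<and> one M = undefined \<and>
     case_prod (add M) \<in> extensional (carrier M \<times> carrier M) \<and>
     case_prod (smult M) \<in> extensional (carrier B \<times> carrier M)"

definition linear_maps ::
  "('b, 'y) ring_scheme \<Rightarrow> ('b, 'm, 'z) module_scheme \<Rightarrow> ('b, 'n, 'w) module_scheme
     \<Rightarrow> ('m \<Rightarrow> 'n) set" where
  "linear_maps B M N = {f \<in> carrier M \<rightarrow>\<^sub>E carrier N.
     (\<forall>x\<in>carrier M. \<forall>y\<in>carrier M. f (x \<oplus>\<^bsub>M\<^esub> y) = f x \<oplus>\<^bsub>N\<^esub> f y) \<and>
     (\<forall>b\<in>carrier B. \<forall>x\<in>carrier M. f (b \<odot>\<^bsub>M\<^esub> x) = b \<odot>\<^bsub>N\<^esub> f x)}"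

text \<open>$B$-Mod, restricted to the modules whose elements are taken from the type \<open>'m\<close>.\<close>

definition module_category :: "('b, 'y) ring_scheme \<Rightarrow> (('b, 'm) module, 'm \<Rightarrow> 'm) cat" where
  "module_category B =
     \<lparr>Obj = {M. unital_module B M \<and> normalized_module B M},
      Hom = linear_maps B,
      Ident = (\<lambda>M. \<lambda>x\<in>carrier M. x),
      Comp = (\<lambda>L M N g f. compose (carrier L) g f)\<rparr>"


section \<open>The category of graded unital modules\<close>

record ('b, 'm, 'g) graded_module = "('b, 'm) module" +
  part :: "'g \<Rightarrow> 'm set"

definition is_graded_module ::
  "('g, 'x) monoid_scheme \<Rightarrow> ('a, 'y) ring_scheme \<Rightarrow> ('g \<Rightarrow> 'a set) \<Rightarrow> ('a, 'm, 'g) graded_module \<Rightarrow> bool"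
  where
  "is_graded_module G A \<A> M \<longleftrightarrow> unital_module A M \<and>
     internal_direct_sum M (carrier G) (part M) \<and>
     (\<forall>\<alpha>\<in>carrier G. \<forall>\<gamma>\<in>carrier G. \<forall>a\<in>\<A> \<alpha>. \<forall>x\<in>part M \<gamma>. a \<odot>\<^bsub>M\<^esub> x \<in> part M (\<alpha> \<otimes>\<^bsub>G\<^esub> \<gamma>))"

text \<open>$A$-Gr, restricted to the modules whose elements are taken from the type \<open>'m\<close>.\<close>

definition graded_module_category ::
  "('g, 'x) monoid_scheme \<Rightarrow> ('a, 'y) ring_scheme \<Rightarrow> ('g \<Rightarrow> 'a set)
     \<Rightarrow> (('a, 'm, 'g) graded_module, 'm \<Rightarrow> 'm) cat" where
  "graded_module_category G A \<A> =
     \<lparr>Obj = {M. is_graded_module G A \<A> M \<and> normalized_module A M \<and> part M \<in> extensional (carrier G)},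
      Hom = (\<lambda>M N. {f \<in> linear_maps A M N. \<forall>\<gamma>\<in>carrier G. f ` part M \<gamma> \<subseteq> part N \<gamma>}),
      Ident = (\<lambda>M. \<lambda>x\<in>carrier M. x),
      Comp = (\<lambda>L M N g f. compose (carrier L) g f)\<rparr>"

definition graded_shift ::
  "('g, 'x) monoid_scheme \<Rightarrow> 'g
     \<Rightarrow> (('a, 'm, 'g) graded_module, 'm \<Rightarrow> 'm, ('a, 'm, 'g) graded_module, 'm \<Rightarrow> 'm) func" where
  "graded_shift G \<alpha> =
     \<lparr>fob = (\<lambda>M. M\<lparr>part := (\<lambda>\<gamma>\<in>carrier G. part M (\<gamma> \<otimes>\<^bsub>G\<^esub> \<alpha>))\<rparr>),
      fmor = (\<lambda>M N f. f)\<rparr>"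


section \<open>The smash product\<close>

text \<open>
  The formal sum $\sum_\gamma r^{(\gamma)} p_\gamma$ is the finitely supported function
  \<open>\<gamma> \<mapsto> r\<^sup>(\<^sup>\<gamma>\<^sup>)\<close>. Expanding the product of $\sum_\alpha f(\alpha) p_\alpha$ and
  $\sum_\beta g(\beta) p_\beta$ biadditively by $(rp_\alpha)(sp_\beta) = r s_{\alpha\beta^{-1}} p_\beta$
  gives $\sum_\alpha f(\alpha)\, g(\beta)_{\alpha\beta^{-1}}$ as the coefficient of $p_\beta$.
\<close>

definition smash_product ::
  "('g, 'x) monoid_scheme \<Rightarrow> ('a, 'y) ring_scheme \<Rightarrow> ('g \<Rightarrow> 'a set) \<Rightarrow> ('g \<Rightarrow> 'a) ring" where
  "smash_product G A \<A> =
     \<lparr>carrier = {f \<in> carrier G \<rightarrow>\<^sub>E carrier A. finite {\<gamma> \<in> carrier G. f \<gamma> \<noteq> \<zero>\<^bsub>A\<^esub>}},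
      mult = (\<lambda>f g. \<lambda>\<beta>\<in>carrier G.
        \<Oplus>\<^bsub>A\<^esub>\<alpha>\<in>{\<alpha> \<in> carrier G. f \<alpha> \<noteq> \<zero>\<^bsub>A\<^esub>}.
          f \<alpha> \<otimes>\<^bsub>A\<^esub> component G A \<A> (g \<beta>) (\<alpha> \<otimes>\<^bsub>G\<^esub> inv\<^bsub>G\<^esub> \<beta>)),
      one = undefined,
      zero = (\<lambda>\<gamma>\<in>carrier G. \<zero>\<^bsub>A\<^esub>),
      add = (\<lambda>f g. \<lambda>\<gamma>\<in>carrier G. f \<gamma> \<oplus>\<^bsub>A\<^esub> g \<gamma>)\<rparr>"

text \<open>
  $\mathcal{S}^\alpha(\sum_\gamma r^{(\gamma)} p_\gamma) = \sum_\gamma r^{(\gamma)} p_{\gamma\alpha}$, so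
  the coefficient of $p_\beta$ is $r^{(\beta\alpha^{-1})}$.
\<close>

definition smash_shift :: "('g, 'x) monoid_scheme \<Rightarrow> 'g \<Rightarrow> ('g \<Rightarrow> 'a) \<Rightarrow> 'g \<Rightarrow> 'a" where
  "smash_shift G \<alpha> f = (\<lambda>\<beta>\<in>carrier G. f (\<beta> \<otimes>\<^bsub>G\<^esub> inv\<^bsub>G\<^esub> \<alpha>))"

definition smash_module_shift ::
  "('g, 'x) monoid_scheme \<Rightarrow> ('a, 'y) ring_scheme \<Rightarrow> ('g \<Rightarrow> 'a set) \<Rightarrow> 'g
     \<Rightarrow> (('g \<Rightarrow> 'a, 'm) module, 'm \<Rightarrow> 'm, ('g \<Rightarrow> 'a, 'm) module, 'm \<Rightarrow> 'm) func" where
  "smash_module_shift G A \<A> \<alpha> =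
     \<lparr>fob = (\<lambda>M. M\<lparr>smult := (\<lambda>a x.
        if a \<in> carrier (smash_product G A \<A>) \<and> x \<in> carrier M
        then smash_shift G \<alpha> a \<odot>\<^bsub>M\<^esub> x else undefined)\<rparr>),
      fmor = (\<lambda>M N f. f)\<rparr>"

end

theory Submission
  imports Defs
begin

text \<open>
  A graded module \<open>M\<close> becomes a module over $A \#\Gamma$ by letting $p_\gamma$ act as the projection to
  $M_\gamma$, so that $(\sum_\gamma r^{(\gamma)} p_\gamma) x = \sum_\gamma r^{(\gamma)} x_\gamma$.
  Conversely, let \<open>N\<close> be a unital module over $A \#\Gamma$. Homogeneous idempotents of \<open>A\<close> have degree
  $\varepsilon$, and the elements $\sum_{\gamma\in F} e p_\gamma$ with \<open>e\<close> such an idempotent and \<open>F\<close>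
  finite are left local units of $A \#\Gamma$; hence every \<open>x\<close> in \<open>N\<close> is fixed by one of them. Then
  $x_\gamma = e p_\gamma x$ is a grading and $a x = \sum_{\gamma\in F} a p_\gamma x$ is an action of
  \<open>A\<close>. Both constructions keep the additive group and the maps, and they are mutually inverse.
  In $M(\alpha)$ the symbol $p_\gamma$ projects to $M_{\gamma\alpha}$, as does $p_{\gamma\alpha}$ in \<open>M\<close>,
  which gives the compatibility with the shifts.
\<close>

section \<open>Graded abelian groups\<close>

text \<open>As \<open>A\<close> need not have a unit, \<open>p_\<gamma>\<close> is in general no
  element of the smash product; only monomials such as \<open>e p_\<gamma>\<close> are available,
  and \<open>e\<close> has to depend on the module element. The way back from the smash product
  therefore rests on choices of \<open>e\<close> and \<open>F\<close>, and these are compared by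
  domination: if \<open>e' e = e\<close> and \<open>F\<close> is contained in \<open>F'\<close>,
  then \<open>e'\<close> and \<open>F'\<close> fix whatever \<open>e\<close> and \<open>F\<close>
  fix. This works because \<open>e\<close> has degree \<epsilon>: then
  \<open>(a p_\<alpha>)(e p_\<beta>)\<close> is \<open>a e p_\<beta>\<close> for \<alpha> = \<beta>
  and zero otherwise, so multiplying by such elements on the right just intersects index sets.
  Multiplication on the left behaves differently: each \<open>a p_\<alpha>\<close> selects one
  homogeneous component of the coefficient to its right, so the index set must be large enough to
  catch all of them. Since an isomorphism and not merely an equivalence is wanted, the round trips
  must return equal records, including the values of the operations off the carriers.\<close>

lemma additive_zero:
  assumes "abelian_group M" "abelian_group N" "h \<in> carrier M \<rightarrow> carrier N"
    and "\<And>x y. x \<in> carrier M \<Longrightarrow> y \<in> carrier M \<Longrightarrow> h (x \<oplus>\<^bsub>M\<^esub> y) = h x \<oplus>\<^bsub>N\<^esub> h y"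
  shows "h \<zero>\<^bsub>M\<^esub> = \<zero>\<^bsub>N\<^esub>"
proof -
  interpret M: abelian_group M by fact
  interpret N: abelian_group N by fact
  have z: "h \<zero>\<^bsub>M\<^esub> \<in> carrier N" using assms(3) by auto
  have "h \<zero>\<^bsub>M\<^esub> \<oplus>\<^bsub>N\<^esub> h \<zero>\<^bsub>M\<^esub> = h \<zero>\<^bsub>M\<^esub>"
    using assms(4)[of "\<zero>\<^bsub>M\<^esub>" "\<zero>\<^bsub>M\<^esub>"] by simp
  then show ?thesis using z by (metis N.add.r_cancel_one')
qed

lemma additive_finsum:
  assumes "abelian_group M" "abelian_group N" "h \<in> carrier M \<rightarrow> carrier N"
    and "\<And>x y. x \<in> carrier M \<Longrightarrow> y \<in> carrier M \<Longrightarrow> h (x \<oplus>\<^bsub>M\<^esub> y) = h x \<oplus>\<^bsub>N\<^esub> h y"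
    and "f \<in> S \<rightarrow> carrier M"
  shows "h (finsum M f S) = (\<Oplus>\<^bsub>N\<^esub>i\<in>S. h (f i))"
proof -
  interpret M: abelian_group M by fact
  interpret N: abelian_group N by fact
  have zero: "h \<zero>\<^bsub>M\<^esub> = \<zero>\<^bsub>N\<^esub>" by (rule additive_zero[OF assms(1-4)])
  show ?thesis using assms(5)
  proof (induction S rule: infinite_finite_induct)
    case (infinite S)
    \<comment> \<open>An infinite \<open>finsum\<close> is zero by convention, so this case is
      \<open>h\<close> preserving zero.\<close>
    then show ?case by (simp add: zero M.finsum_infinite N.finsum_infinite)
  next
    case empty
    then show ?case by (simp add: zero)
  next
    case (insert i S)
    have fS: "f \<in> S \<rightarrow> carrier M" and fi: "f i \<in> carrier M" using insert.prems by auto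
    have "(\<lambda>i. h (f i)) \<in> S \<rightarrow> carrier N" "h (f i) \<in> carrier N"
      using fS fi assms(3) by auto
    then show ?case
      using insert fS fi by (simp add: M.finsum_insert N.finsum_insert M.finsum_closed assms(4))
  qed
qed

text \<open>\<open>G\<close> enters only as an index set, so that one locale serves the grading of
  the ring, the gradings of modules and all their shifts.\<close>

locale graded_group = abelian_group M
  for G :: "('g, 'x) monoid_scheme" and M :: "('m, 'z) ring_scheme" (structure)
    and P :: "'g \<Rightarrow> 'm set" +
  assumes ids: "internal_direct_sum M (carrier G) P"
begin

abbreviation "cmp \<equiv> component G M P"

lemma part_subgroup: "\<gamma> \<in> carrier G \<Longrightarrow> subgroup (P \<gamma>) (add_monoid M)"
  using ids by (simp add: internal_direct_sum_def)

lemma part_carrier: "\<lbrakk>\<gamma> \<in> carrier G; x \<in> P \<gamma>\<rbrakk> \<Longrightarrow> x \<in> carrier M"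
  using part_subgroup[THEN subgroup.subset] by auto

lemma part_zero: "\<gamma> \<in> carrier G \<Longrightarrow> \<zero> \<in> P \<gamma>"
  using part_subgroup[THEN subgroup.one_closed] by auto

lemma part_add: "\<lbrakk>\<gamma> \<in> carrier G; x \<in> P \<gamma>; y \<in> P \<gamma>\<rbrakk> \<Longrightarrow> x \<oplus> y \<in> P \<gamma>"
  using part_subgroup[THEN subgroup.m_closed, of \<gamma> x y] by simp

lemma decomposition_component:
  assumes "x \<in> carrier M" shows "decomposition M (carrier G) P x (cmp x)"
  using ids assms unfolding internal_direct_sum_def component_def by (metis theI')

lemma component_eq:
  assumes "x \<in> carrier M" "decomposition M (carrier G) P x c" shows "cmp x = c"
  using ids assms unfolding internal_direct_sum_def component_def by (metis the_equality)

lemma component_part: "\<lbrakk>x \<in> carrier M; \<gamma> \<in> carrier G\<rbrakk> \<Longrightarrow> cmp x \<gamma> \<in> P \<gamma>"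
  using decomposition_component[of x] unfolding decomposition_def by auto

lemma component_closed: "\<lbrakk>x \<in> carrier M; \<gamma> \<in> carrier G\<rbrakk> \<Longrightarrow> cmp x \<gamma> \<in> carrier M"
  using component_part part_carrier by blast

lemma finite_component: "x \<in> carrier M \<Longrightarrow> finite {\<gamma> \<in> carrier G. cmp x \<gamma> \<noteq> \<zero>}"
  using decomposition_component[of x] unfolding decomposition_def by auto

lemma component_sum:
  assumes "x \<in> carrier M" shows "x = (\<Oplus>\<gamma>\<in>{\<gamma> \<in> carrier G. cmp x \<gamma> \<noteq> \<zero>}. cmp x \<gamma>)"
  using decomposition_component[OF assms] unfolding decomposition_def by auto

lemma component_sum_superset:
  assumes "x \<in> carrier M" "finite F" "F \<subseteq> carrier G"
    and "\<And>\<gamma>. \<gamma> \<in> carrier G \<Longrightarrow> cmp x \<gamma> \<noteq> \<zero> \<Longrightarrow> \<gamma> \<in> F"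
  shows "(\<Oplus>\<gamma>\<in>F. cmp x \<gamma>) = x"
proof -
  have "(\<Oplus>\<gamma>\<in>{\<gamma> \<in> carrier G. cmp x \<gamma> \<noteq> \<zero>}. cmp x \<gamma>) = (\<Oplus>\<gamma>\<in>F. cmp x \<gamma>)"
    by (rule add.finprod_mono_neutral_cong_left) (use assms component_closed in auto)
  then show ?thesis using component_sum[OF assms(1)] by simp
qed

text \<open>Components are defined by \<open>THE\<close>; uniqueness of decompositions lets them be
  read off any finite sum of elements of the parts. The three rules for components that follow are
  obtained from this one.\<close>

lemma component_finsum_parts:
  assumes "finite F" "F \<subseteq> carrier G" "\<And>\<gamma>. \<gamma> \<in> F \<Longrightarrow> c \<gamma> \<in> P \<gamma>" "\<delta> \<in> carrier G"
  shows "cmp (\<Oplus>\<gamma>\<in>F. c \<gamma>) \<delta> = (if \<delta> \<in> F then c \<delta> else \<zero>)"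
proof -
  \<comment> \<open>A decomposition is a function on the whole carrier, so \<open>c\<close> is
    continued by zero outside \<open>F\<close>.\<close>
  let ?c = "\<lambda>\<gamma>\<in>carrier G. if \<gamma> \<in> F then c \<gamma> else \<zero>"
  have cl: "c \<gamma> \<in> carrier M" if "\<gamma> \<in> F" for \<gamma> using that assms part_carrier by blast
  have sum: "(\<Oplus>\<gamma>\<in>F. c \<gamma>) = (\<Oplus>\<gamma>\<in>{\<gamma> \<in> carrier G. ?c \<gamma> \<noteq> \<zero>}. ?c \<gamma>)"
    by (rule add.finprod_mono_neutral_cong_right) (use assms cl in \<open>auto split: if_splits\<close>)
  have fin: "finite {\<gamma> \<in> carrier G. ?c \<gamma> \<noteq> \<zero>}"
    by (rule finite_subset[OF _ assms(1)]) (auto split: if_splits)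
  have "decomposition M (carrier G) P (\<Oplus>\<gamma>\<in>F. c \<gamma>) ?c"
    unfolding decomposition_def
  proof (intro conjI)
    show "?c \<in> (\<Pi>\<^sub>E \<gamma>\<in>carrier G. P \<gamma>)" using assms part_zero by auto
  qed (rule fin sum)+
  moreover have "(\<Oplus>\<gamma>\<in>F. c \<gamma>) \<in> carrier M" using cl by (auto intro: finsum_closed)
  ultimately have "cmp (\<Oplus>\<gamma>\<in>F. c \<gamma>) = ?c" by (intro component_eq) auto
  then show ?thesis using assms(4) by simp
qed

lemma component_homogeneous:
  assumes "\<gamma> \<in> carrier G" "x \<in> P \<gamma>" "\<delta> \<in> carrier G"
  shows "cmp x \<delta> = (if \<delta> = \<gamma> then x else \<zero>)"
  using component_finsum_parts[of "{\<gamma>}" "\<lambda>_. x" \<delta>] assms part_carrier by auto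

lemma component_zero: "\<gamma> \<in> carrier G \<Longrightarrow> cmp \<zero> \<gamma> = \<zero>"
  using component_finsum_parts[of "{}"] by auto

lemma component_add:
  assumes "x \<in> carrier M" "y \<in> carrier M" "\<gamma> \<in> carrier G"
  shows "cmp (x \<oplus> y) \<gamma> = cmp x \<gamma> \<oplus> cmp y \<gamma>"
proof -
  \<comment> \<open>The union of the two supports serves both summands, so the sums can be added
    term by term.\<close>
  let ?F = "{\<gamma> \<in> carrier G. cmp x \<gamma> \<noteq> \<zero>} \<union> {\<gamma> \<in> carrier G. cmp y \<gamma> \<noteq> \<zero>}"
  have F: "finite ?F" "?F \<subseteq> carrier G" using finite_component assms by auto
  have cl: "cmp x \<in> ?F \<rightarrow> carrier M" "cmp y \<in> ?F \<rightarrow> carrier M"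
    using assms component_closed by auto
  have "x \<oplus> y = (\<Oplus>\<gamma>\<in>?F. cmp x \<gamma>) \<oplus> (\<Oplus>\<gamma>\<in>?F. cmp y \<gamma>)"
    using component_sum_superset[OF _ F] assms by auto
  also have "\<dots> = (\<Oplus>\<gamma>\<in>?F. cmp x \<gamma> \<oplus> cmp y \<gamma>)" by (rule finsum_addf[OF cl, symmetric])
  also have "cmp \<dots> \<gamma> = (if \<gamma> \<in> ?F then cmp x \<gamma> \<oplus> cmp y \<gamma> else \<zero>)"
    by (rule component_finsum_parts[OF F]) (use assms component_part part_add in auto)
  finally have "cmp (x \<oplus> y) \<gamma> = (if \<gamma> \<in> ?F then cmp x \<gamma> \<oplus> cmp y \<gamma> else \<zero>)" .
  then show ?thesis using assms(3) by (cases "\<gamma> \<in> ?F") simp_all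
qed

text \<open>An element is the sum of its components, so a property that is stable under addition
  needs to be checked on the parts only. Zero is an instance of the case \<open>homogeneous\<close>,
  since it lies in every part; \<open>ne\<close> provides such a part.\<close>

lemma homogeneous_induct [consumes 1, case_names homogeneous add]:
  assumes "x \<in> carrier M"
    and hom: "\<And>\<gamma> x. \<gamma> \<in> carrier G \<Longrightarrow> x \<in> P \<gamma> \<Longrightarrow> Q x"
    and add: "\<And>x y. x \<in> carrier M \<Longrightarrow> y \<in> carrier M \<Longrightarrow> Q x \<Longrightarrow> Q y \<Longrightarrow> Q (x \<oplus> y)"
    and ne: "carrier G \<noteq> {}"
  shows "Q x"
proof -
  have "finite F \<Longrightarrow> F \<subseteq> carrier G \<Longrightarrow> Q (\<Oplus>\<gamma>\<in>F. cmp x \<gamma>)" for F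
  proof (induction F rule: finite_induct)
    case empty
    obtain \<gamma> where "\<gamma> \<in> carrier G" using ne by blast
    then show ?case using hom[OF _ part_zero] by simp
  next
    case (insert \<gamma> F)
    have cl: "cmp x \<in> F \<rightarrow> carrier M" "cmp x \<gamma> \<in> carrier M"
      using insert.prems assms(1) component_closed by auto
    have "Q (cmp x \<gamma>)" using insert.prems assms(1) by (intro hom[of \<gamma>] component_part) auto
    then have "Q (cmp x \<gamma> \<oplus> (\<Oplus>\<gamma>\<in>F. cmp x \<gamma>))"
      using insert by (intro add cl(2) finsum_closed[OF cl(1)]) auto
    then show ?case using insert cl by (simp add: finsum_insert)
  qed
  from this[OF finite_component[OF assms(1)]] show ?thesis
    by (subst component_sum[OF assms(1)]) auto
qed

end

section \<open>The action of the smash product on a graded module\<close>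

lemma (in nonunital_ring) r_null: "x \<in> carrier R \<Longrightarrow> x \<otimes> \<zero> = \<zero>"
  by (rule additive_zero[where h = "\<lambda>y. x \<otimes> y" and M = R])
    (auto simp: m_closed r_distr abelian_group_axioms)

lemma (in nonunital_ring) l_null: "x \<in> carrier R \<Longrightarrow> \<zero> \<otimes> x = \<zero>"
  by (rule additive_zero[where h = "\<lambda>y. y \<otimes> x" and M = R])
    (auto simp: m_closed l_distr abelian_group_axioms)

context left_module
begin

lemma smult_r_null: "a \<in> carrier B \<Longrightarrow> a \<odot>\<^bsub>M\<^esub> \<zero>\<^bsub>M\<^esub> = \<zero>\<^bsub>M\<^esub>"
  by (rule additive_zero[where h = "\<lambda>y. a \<odot>\<^bsub>M\<^esub> y" and M = M])
    (auto simp: smult_closed smult_r_distr M.abelian_group_axioms)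

lemma smult_l_null: "x \<in> carrier M \<Longrightarrow> \<zero>\<^bsub>B\<^esub> \<odot>\<^bsub>M\<^esub> x = \<zero>\<^bsub>M\<^esub>"
  by (rule additive_zero[where h = "\<lambda>b. b \<odot>\<^bsub>M\<^esub> x" and M = B])
    (auto simp: smult_closed smult_l_distr M.abelian_group_axioms B.abelian_group_axioms)

lemma smult_finsum_right:
  "\<lbrakk>a \<in> carrier B; f \<in> S \<rightarrow> carrier M\<rbrakk>
    \<Longrightarrow> a \<odot>\<^bsub>M\<^esub> (\<Oplus>\<^bsub>M\<^esub>i\<in>S. f i) = (\<Oplus>\<^bsub>M\<^esub>i\<in>S. a \<odot>\<^bsub>M\<^esub> f i)"
  by (rule additive_finsum[where h = "\<lambda>y. a \<odot>\<^bsub>M\<^esub> y" and M = M])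
    (auto simp: smult_closed smult_r_distr M.abelian_group_axioms)

lemma smult_finsum_left:
  "\<lbrakk>x \<in> carrier M; f \<in> S \<rightarrow> carrier B\<rbrakk>
    \<Longrightarrow> (\<Oplus>\<^bsub>B\<^esub>i\<in>S. f i) \<odot>\<^bsub>M\<^esub> x = (\<Oplus>\<^bsub>M\<^esub>i\<in>S. f i \<odot>\<^bsub>M\<^esub> x)"
  by (rule additive_finsum[where h = "\<lambda>b. b \<odot>\<^bsub>M\<^esub> x" and M = B])
    (auto simp: smult_closed smult_l_distr M.abelian_group_axioms B.abelian_group_axioms)

end

sublocale graded_ring \<subseteq> AC: graded_group G A \<A>
  by unfold_locales (rule direct_sum)

text \<open>Summing over the support of \<open>f\<close> makes the sum finite;
  \<open>act_superset\<close> moves it to other index sets. The grading is an argument of its own,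
  so that the action can be formed for several gradings of the same record.\<close>

definition smash_act ::
  "('g, 'x) monoid_scheme \<Rightarrow> ('a, 'y) ring_scheme \<Rightarrow> ('a, 'm, 'z) module_scheme \<Rightarrow> ('g \<Rightarrow> 'm set)
    \<Rightarrow> ('g \<Rightarrow> 'a) \<Rightarrow> 'm \<Rightarrow> 'm" where
  "smash_act G A M P f x =
    (\<Oplus>\<^bsub>M\<^esub>\<gamma>\<in>{\<gamma> \<in> carrier G. f \<gamma> \<noteq> \<zero>\<^bsub>A\<^esub>}. f \<gamma> \<odot>\<^bsub>M\<^esub> component G M P x \<gamma>)"

text \<open>\<open>slice G A a F\<close> is the element $\sum_{\gamma\in F} a p_\gamma$ of the smash product.\<close>

definition slice :: "('g, 'x) monoid_scheme \<Rightarrow> ('a, 'y) ring_scheme \<Rightarrow> 'a \<Rightarrow> 'g set \<Rightarrow> 'g \<Rightarrow> 'a" where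
  "slice G A a F = (\<lambda>\<gamma>\<in>carrier G. if \<gamma> \<in> F then a else \<zero>\<^bsub>A\<^esub>)"

context graded_ring
begin

abbreviation "Sm \<equiv> smash_product G A \<A>"

lemma smash_carrier:
  "carrier Sm = {f \<in> carrier G \<rightarrow>\<^sub>E carrier A. finite {\<gamma> \<in> carrier G. f \<gamma> \<noteq> \<zero>\<^bsub>A\<^esub>}}"
  by (simp add: smash_product_def)

lemma smash_value: "\<lbrakk>f \<in> carrier Sm; \<gamma> \<in> carrier G\<rbrakk> \<Longrightarrow> f \<gamma> \<in> carrier A"
  by (auto simp: smash_carrier)

lemma smash_finite: "f \<in> carrier Sm \<Longrightarrow> finite {\<gamma> \<in> carrier G. f \<gamma> \<noteq> \<zero>\<^bsub>A\<^esub>}"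
  by (auto simp: smash_carrier)

lemma smash_ext:
  "\<lbrakk>f \<in> carrier Sm; g \<in> carrier Sm; \<And>\<gamma>. \<gamma> \<in> carrier G \<Longrightarrow> f \<gamma> = g \<gamma>\<rbrakk> \<Longrightarrow> f = g"
  by (auto simp: smash_carrier intro: PiE_ext)

lemma smash_add: "\<gamma> \<in> carrier G \<Longrightarrow> (f \<oplus>\<^bsub>Sm\<^esub> g) \<gamma> = f \<gamma> \<oplus>\<^bsub>A\<^esub> g \<gamma>"
  by (simp add: smash_product_def)

lemma smash_zero: "\<gamma> \<in> carrier G \<Longrightarrow> \<zero>\<^bsub>Sm\<^esub> \<gamma> = \<zero>\<^bsub>A\<^esub>"
  by (simp add: smash_product_def)

lemma smash_mult_apply:
  "\<beta> \<in> carrier G \<Longrightarrow> (f \<otimes>\<^bsub>Sm\<^esub> g) \<beta> =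
    (\<Oplus>\<^bsub>A\<^esub>\<alpha>\<in>{\<alpha> \<in> carrier G. f \<alpha> \<noteq> \<zero>\<^bsub>A\<^esub>}. f \<alpha> \<otimes>\<^bsub>A\<^esub> AC.cmp (g \<beta>) (\<alpha> \<otimes>\<^bsub>G\<^esub> inv\<^bsub>G\<^esub> \<beta>))"
  by (simp add: smash_product_def)

lemma smash_add_closed:
  assumes "f \<in> carrier Sm" "g \<in> carrier Sm" shows "f \<oplus>\<^bsub>Sm\<^esub> g \<in> carrier Sm"
proof -
  have "{\<gamma> \<in> carrier G. f \<gamma> \<oplus>\<^bsub>A\<^esub> g \<gamma> \<noteq> \<zero>\<^bsub>A\<^esub>}
      \<subseteq> {\<gamma> \<in> carrier G. f \<gamma> \<noteq> \<zero>\<^bsub>A\<^esub>} \<union> {\<gamma> \<in> carrier G. g \<gamma> \<noteq> \<zero>\<^bsub>A\<^esub>}" by auto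
  then have fin: "finite {\<gamma> \<in> carrier G. f \<gamma> \<oplus>\<^bsub>A\<^esub> g \<gamma> \<noteq> \<zero>\<^bsub>A\<^esub>}"
    by (rule finite_subset) (use assms smash_finite in simp)
  have "f \<oplus>\<^bsub>Sm\<^esub> g \<in> carrier G \<rightarrow>\<^sub>E carrier A"
    using assms smash_value by (auto simp: smash_product_def)
  moreover have "{\<gamma> \<in> carrier G. (f \<oplus>\<^bsub>Sm\<^esub> g) \<gamma> \<noteq> \<zero>\<^bsub>A\<^esub>} = {\<gamma> \<in> carrier G. f \<gamma> \<oplus>\<^bsub>A\<^esub> g \<gamma> \<noteq> \<zero>\<^bsub>A\<^esub>}"
    using smash_add by auto
  ultimately show ?thesis using fin by (simp add: smash_carrier)
qed

lemma smash_zero_closed: "\<zero>\<^bsub>Sm\<^esub> \<in> carrier Sm"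
  by (auto simp: smash_product_def)

lemma smash_abelian_group: "abelian_group Sm"
proof (rule abelian_groupI)
  fix f g h assume f: "f \<in> carrier Sm" and g: "g \<in> carrier Sm" and h: "h \<in> carrier Sm"
  note cl = f g h smash_add_closed smash_value
  show "f \<oplus>\<^bsub>Sm\<^esub> g \<in> carrier Sm" using f g by (rule smash_add_closed)
  show "f \<oplus>\<^bsub>Sm\<^esub> g \<oplus>\<^bsub>Sm\<^esub> h = f \<oplus>\<^bsub>Sm\<^esub> (g \<oplus>\<^bsub>Sm\<^esub> h)"
    by (rule smash_ext) (simp_all add: cl smash_add A.a_assoc)
  show "f \<oplus>\<^bsub>Sm\<^esub> g = g \<oplus>\<^bsub>Sm\<^esub> f"
    by (rule smash_ext) (simp_all add: cl smash_add A.a_comm)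
  show "\<zero>\<^bsub>Sm\<^esub> \<oplus>\<^bsub>Sm\<^esub> f = f"
    by (rule smash_ext) (simp_all add: cl smash_add smash_zero smash_zero_closed)
  let ?g = "\<lambda>\<gamma>\<in>carrier G. \<ominus>\<^bsub>A\<^esub> f \<gamma>"
  have "{\<gamma> \<in> carrier G. ?g \<gamma> \<noteq> \<zero>\<^bsub>A\<^esub>} \<subseteq> {\<gamma> \<in> carrier G. f \<gamma> \<noteq> \<zero>\<^bsub>A\<^esub>}"
    by auto
  then have "finite {\<gamma> \<in> carrier G. ?g \<gamma> \<noteq> \<zero>\<^bsub>A\<^esub>}"
    by (rule finite_subset) (rule smash_finite[OF f])
  then have g: "?g \<in> carrier Sm" using smash_value[OF f] by (simp add: smash_carrier)
  have "?g \<oplus>\<^bsub>Sm\<^esub> f = \<zero>\<^bsub>Sm\<^esub>"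
    by (rule smash_ext) (use g in \<open>simp_all add: cl smash_add smash_zero smash_zero_closed A.l_neg\<close>)
  with g show "\<exists>g\<in>carrier Sm. g \<oplus>\<^bsub>Sm\<^esub> f = \<zero>\<^bsub>Sm\<^esub>" by blast
qed (rule smash_zero_closed)

lemma slice_closed:
  assumes "a \<in> carrier A" "finite F" shows "slice G A a F \<in> carrier Sm"
proof -
  have "{\<gamma> \<in> carrier G. slice G A a F \<gamma> \<noteq> \<zero>\<^bsub>A\<^esub>} \<subseteq> F" by (auto simp: slice_def)
  then have "finite {\<gamma> \<in> carrier G. slice G A a F \<gamma> \<noteq> \<zero>\<^bsub>A\<^esub>}" using assms(2) finite_subset by blast
  then show ?thesis using assms(1) by (auto simp: smash_carrier slice_def)
qed

lemma slice_apply: "\<gamma> \<in> carrier G \<Longrightarrow> slice G A a F \<gamma> = (if \<gamma> \<in> F then a else \<zero>\<^bsub>A\<^esub>)"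
  by (simp add: slice_def)

end

locale graded_left_module = graded_ring G A \<A> + left_module A M
  for G :: "('g, 'x) monoid_scheme" and A :: "('a, 'y) ring_scheme" and \<A> :: "'g \<Rightarrow> 'a set"
    and M :: "('a, 'm, 'z) module_scheme" and P :: "'g \<Rightarrow> 'm set" +
  assumes module_direct_sum: "internal_direct_sum M (carrier G) P"
    and smult_part: "\<lbrakk>\<alpha> \<in> carrier G; \<gamma> \<in> carrier G; a \<in> \<A> \<alpha>; x \<in> P \<gamma>\<rbrakk>
      \<Longrightarrow> a \<odot>\<^bsub>M\<^esub> x \<in> P (\<alpha> \<otimes>\<^bsub>G\<^esub> \<gamma>)"

sublocale graded_left_module \<subseteq> MC: graded_group G M P
  by unfold_locales (rule module_direct_sum)

context graded_left_module
begin

abbreviation "act \<equiv> smash_act G A M P"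

text \<open>Both sides are additive in \<open>a\<close>, and for \<open>a\<close> of degree \<delta>
  they can be nonzero only if \<alpha> = \<delta>\<beta>. This is where the index
  \<alpha>\<beta>^{-1} in the multiplication of the smash product comes from.\<close>

lemma component_smult:
  assumes a: "a \<in> carrier A" and \<beta>: "\<beta> \<in> carrier G" and x: "x \<in> P \<beta>" and \<alpha>: "\<alpha> \<in> carrier G"
  shows "MC.cmp (a \<odot>\<^bsub>M\<^esub> x) \<alpha> = AC.cmp a (\<alpha> \<otimes>\<^bsub>G\<^esub> inv\<^bsub>G\<^esub> \<beta>) \<odot>\<^bsub>M\<^esub> x"
  using a
proof (induction a rule: AC.homogeneous_induct)
  case (homogeneous \<delta> a)
  have xM: "x \<in> carrier M" using MC.part_carrier \<beta> x by blast
  have "\<alpha> = \<delta> \<otimes>\<^bsub>G\<^esub> \<beta> \<longleftrightarrow> \<alpha> \<otimes>\<^bsub>G\<^esub> inv\<^bsub>G\<^esub> \<beta> = \<delta>"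
    using homogeneous \<alpha> \<beta> by (metis G.inv_solve_right')
  then show ?case
    using homogeneous \<alpha> \<beta> smult_part[OF _ \<beta> _ x] xM
    by (auto simp: MC.component_homogeneous[of "\<delta> \<otimes>\<^bsub>G\<^esub> \<beta>"] AC.component_homogeneous smult_l_null)
next
  case (add a b)
  have xM: "x \<in> carrier M" using MC.part_carrier \<beta> x by blast
  show ?case
    using add \<alpha> \<beta> xM by (simp add: smult_l_distr MC.component_add AC.component_add smult_closed
        AC.component_closed)
next
  show "carrier G \<noteq> {}" using \<alpha> by blast
qed

text \<open>A term vanishes as soon as its coefficient or its component does. So the sum may run
  over the support of \<open>f\<close>, over that of \<open>x\<close>, or over any finite set that
  covers their intersection, whichever stays fixed in the argument at hand.\<close>

lemma act_superset:
  assumes f: "f \<in> carrier Sm" and x: "x \<in> carrier M" and F: "finite F" "F \<subseteq> carrier G"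
    and sup: "\<And>\<gamma>. \<gamma> \<in> carrier G - F \<Longrightarrow> f \<gamma> = \<zero>\<^bsub>A\<^esub> \<or> MC.cmp x \<gamma> = \<zero>\<^bsub>M\<^esub>"
  shows "act f x = (\<Oplus>\<^bsub>M\<^esub>\<gamma>\<in>F. f \<gamma> \<odot>\<^bsub>M\<^esub> MC.cmp x \<gamma>)"
  unfolding smash_act_def
proof (rule M.add.finprod_mono_neutral_cong)
  show "finite {\<gamma> \<in> carrier G. f \<gamma> \<noteq> \<zero>\<^bsub>A\<^esub>}" "finite F" using f F smash_finite by auto
  show "f \<gamma> \<odot>\<^bsub>M\<^esub> MC.cmp x \<gamma> = \<zero>\<^bsub>M\<^esub>" if "\<gamma> \<in> F - {\<gamma> \<in> carrier G. f \<gamma> \<noteq> \<zero>\<^bsub>A\<^esub>}" for \<gamma>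
    using that F x MC.component_closed by (auto simp: smult_l_null)
  show "f \<gamma> \<odot>\<^bsub>M\<^esub> MC.cmp x \<gamma> = \<zero>\<^bsub>M\<^esub>" if "\<gamma> \<in> {\<gamma> \<in> carrier G. f \<gamma> \<noteq> \<zero>\<^bsub>A\<^esub>} - F" for \<gamma>
    using that f sup[of \<gamma>] smash_value by (auto simp: smult_r_null)
  show "(\<lambda>\<gamma>. f \<gamma> \<odot>\<^bsub>M\<^esub> MC.cmp x \<gamma>) \<in> {\<gamma> \<in> carrier G. f \<gamma> \<noteq> \<zero>\<^bsub>A\<^esub>} \<rightarrow> carrier M"
    using f x by (auto intro!: smult_closed smash_value MC.component_closed)
  show "(\<lambda>\<gamma>. f \<gamma> \<odot>\<^bsub>M\<^esub> MC.cmp x \<gamma>) \<in> F \<rightarrow> carrier M"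
    using f x F by (auto intro!: smult_closed smash_value MC.component_closed)
qed auto

lemma act_closed: "\<lbrakk>f \<in> carrier Sm; x \<in> carrier M\<rbrakk> \<Longrightarrow> act f x \<in> carrier M"
  unfolding smash_act_def
  by (rule M.finsum_closed) (auto intro!: smult_closed MC.component_closed smash_value)

lemma act_add_right:
  assumes f: "f \<in> carrier Sm" and x: "x \<in> carrier M" and y: "y \<in> carrier M"
  shows "act f (x \<oplus>\<^bsub>M\<^esub> y) = act f x \<oplus>\<^bsub>M\<^esub> act f y"
proof -
  let ?F = "{\<gamma> \<in> carrier G. f \<gamma> \<noteq> \<zero>\<^bsub>A\<^esub>}"
  have "act f (x \<oplus>\<^bsub>M\<^esub> y) = (\<Oplus>\<^bsub>M\<^esub>\<gamma>\<in>?F. f \<gamma> \<odot>\<^bsub>M\<^esub> MC.cmp x \<gamma> \<oplus>\<^bsub>M\<^esub> f \<gamma> \<odot>\<^bsub>M\<^esub> MC.cmp y \<gamma>)"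
    unfolding smash_act_def
    by (rule M.finsum_cong') (use assms smash_value in \<open>auto simp: MC.component_add
        smult_r_distr smult_closed MC.component_closed\<close>)
  also have "\<dots> = act f x \<oplus>\<^bsub>M\<^esub> act f y"
    unfolding smash_act_def
    by (rule M.finsum_addf) (use assms smash_value in \<open>auto simp: smult_closed MC.component_closed\<close>)
  finally show ?thesis .
qed

lemma act_add_left:
  assumes f: "f \<in> carrier Sm" and g: "g \<in> carrier Sm" and x: "x \<in> carrier M"
  shows "act (f \<oplus>\<^bsub>Sm\<^esub> g) x = act f x \<oplus>\<^bsub>M\<^esub> act g x"
proof -
  \<comment> \<open>The support of \<open>x\<close> is one index set for \<open>f\<close>,
    \<open>g\<close> and their sum; the supports of the coefficients may differ.\<close>
  let ?F = "{\<gamma> \<in> carrier G. MC.cmp x \<gamma> \<noteq> \<zero>\<^bsub>M\<^esub>}"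
  have eq: "act h x = (\<Oplus>\<^bsub>M\<^esub>\<gamma>\<in>?F. h \<gamma> \<odot>\<^bsub>M\<^esub> MC.cmp x \<gamma>)" if "h \<in> carrier Sm" for h
    using that x MC.finite_component by (intro act_superset) auto
  have "act (f \<oplus>\<^bsub>Sm\<^esub> g) x = (\<Oplus>\<^bsub>M\<^esub>\<gamma>\<in>?F. f \<gamma> \<odot>\<^bsub>M\<^esub> MC.cmp x \<gamma> \<oplus>\<^bsub>M\<^esub> g \<gamma> \<odot>\<^bsub>M\<^esub> MC.cmp x \<gamma>)"
    unfolding eq[OF smash_add_closed[OF f g]]
    by (rule M.finsum_cong') (use assms smash_value in \<open>auto simp: smash_add smult_l_distr
        smult_closed MC.component_closed\<close>)
  also have "\<dots> = act f x \<oplus>\<^bsub>M\<^esub> act g x"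
    unfolding eq[OF f] eq[OF g]
    by (rule M.finsum_addf) (use assms smash_value in \<open>auto simp: smult_closed MC.component_closed\<close>)
  finally show ?thesis .
qed

lemma act_homogeneous:
  assumes f: "f \<in> carrier Sm" and \<beta>: "\<beta> \<in> carrier G" and x: "x \<in> P \<beta>"
  shows "act f x = f \<beta> \<odot>\<^bsub>M\<^esub> x"
proof -
  have xM: "x \<in> carrier M" using MC.part_carrier \<beta> x by blast
  have "act f x = (\<Oplus>\<^bsub>M\<^esub>\<gamma>\<in>{\<beta>}. f \<gamma> \<odot>\<^bsub>M\<^esub> MC.cmp x \<gamma>)"
    using assms xM by (intro act_superset) (auto simp: MC.component_homogeneous)
  then show ?thesis using assms xM smash_value by (simp add: MC.component_homogeneous smult_closed)
qed

lemma act_slice: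
  assumes "a \<in> carrier A" and x: "x \<in> carrier M" and F: "finite F" "F \<subseteq> carrier G"
  shows "act (slice G A a F) x = a \<odot>\<^bsub>M\<^esub> (\<Oplus>\<^bsub>M\<^esub>\<gamma>\<in>F. MC.cmp x \<gamma>)"
proof -
  have cl: "MC.cmp x \<in> F \<rightarrow> carrier M" using F x MC.component_closed by auto
  have "act (slice G A a F) x = (\<Oplus>\<^bsub>M\<^esub>\<gamma>\<in>F. slice G A a F \<gamma> \<odot>\<^bsub>M\<^esub> MC.cmp x \<gamma>)"
    using assms slice_closed by (intro act_superset) (auto simp: slice_apply)
  also have "\<dots> = (\<Oplus>\<^bsub>M\<^esub>\<gamma>\<in>F. a \<odot>\<^bsub>M\<^esub> MC.cmp x \<gamma>)"
    by (rule M.finsum_cong') (use assms cl in \<open>auto simp: slice_apply intro!: smult_closed\<close>)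
  also have "\<dots> = a \<odot>\<^bsub>M\<^esub> (\<Oplus>\<^bsub>M\<^esub>\<gamma>\<in>F. MC.cmp x \<gamma>)"
    by (rule smult_finsum_right[OF assms(1) cl, symmetric])
  finally show ?thesis .
qed

text \<open>For an infinite group the sum of all \<open>a p_\<gamma>\<close> is in general not in
  the smash product, but on a given \<open>x\<close> a finite part of it already acts as
  \<open>a\<close>.\<close>

lemma act_slice_superset:
  assumes "a \<in> carrier A" "x \<in> carrier M" "finite F" "F \<subseteq> carrier G"
    and "\<And>\<gamma>. \<gamma> \<in> carrier G \<Longrightarrow> MC.cmp x \<gamma> \<noteq> \<zero>\<^bsub>M\<^esub> \<Longrightarrow> \<gamma> \<in> F"
  shows "act (slice G A a F) x = a \<odot>\<^bsub>M\<^esub> x"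
  using act_slice[OF assms(1-4)] MC.component_sum_superset[OF assms(2-5)] by simp

end

section \<open>The smash product is a ring\<close>

text \<open>Right translation by \<beta> permutes the group, so the sum is only reindexed.
  \<open>Q\<close> and \<open>Q'\<close> are arbitrary families of subsets, which lets the lemma be
  used in the opposite direction as well, with the inverse of \<beta>.\<close>

lemma (in graded_group) decomposition_shift:
  assumes "group G" and \<beta>: "\<beta> \<in> carrier G"
    and P': "\<And>\<gamma>. \<gamma> \<in> carrier G \<Longrightarrow> Q' \<gamma> = Q (\<gamma> \<otimes>\<^bsub>G\<^esub> \<beta>)"
    and Q: "\<And>\<gamma>. \<gamma> \<in> carrier G \<Longrightarrow> Q \<gamma> \<subseteq> carrier M"
    and c: "decomposition M (carrier G) Q x c"
  shows "decomposition M (carrier G) Q' x (\<lambda>\<gamma>\<in>carrier G. c (\<gamma> \<otimes>\<^bsub>G\<^esub> \<beta>))"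
proof -
  interpret G: group G by fact
  let ?h = "\<lambda>\<gamma>. \<gamma> \<otimes>\<^bsub>G\<^esub> \<beta>" and ?c = "\<lambda>\<gamma>\<in>carrier G. c (\<gamma> \<otimes>\<^bsub>G\<^esub> \<beta>)"
  let ?S = "{\<gamma> \<in> carrier G. ?c \<gamma> \<noteq> \<zero>}"
  have inj: "inj_on ?h ?S" using \<beta> by (auto intro!: inj_onI)
  have img: "?h ` ?S = {\<gamma> \<in> carrier G. c \<gamma> \<noteq> \<zero>}"
  proof
    show "{\<gamma> \<in> carrier G. c \<gamma> \<noteq> \<zero>} \<subseteq> ?h ` ?S"
    proof
      fix \<gamma> assume \<gamma>: "\<gamma> \<in> {\<gamma> \<in> carrier G. c \<gamma> \<noteq> \<zero>}"
      then have eq: "\<gamma> = ?h (\<gamma> \<otimes>\<^bsub>G\<^esub> inv\<^bsub>G\<^esub> \<beta>)" using \<beta> by (simp add: G.m_assoc)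
      moreover have "\<gamma> \<otimes>\<^bsub>G\<^esub> inv\<^bsub>G\<^esub> \<beta> \<in> ?S" using eq \<gamma> \<beta> by auto
      ultimately show "\<gamma> \<in> ?h ` ?S" by (rule image_eqI)
    qed
  qed (use \<beta> in auto)
  have cP: "c \<gamma> \<in> Q \<gamma>" if "\<gamma> \<in> carrier G" for \<gamma>
    using c that by (auto simp: decomposition_def)
  have cM: "c (\<gamma> \<otimes>\<^bsub>G\<^esub> \<beta>) \<in> carrier M" if "\<gamma> \<in> carrier G" for \<gamma>
    using cP Q G.m_closed[OF that \<beta>] by blast
  have "finite (?h ` ?S)" using c unfolding img decomposition_def by simp
  then have fin: "finite ?S" using inj by (rule finite_imageD)
  have "x = (\<Oplus>\<gamma>\<in>?h ` ?S. c \<gamma>)" using c unfolding img decomposition_def by simp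
  also have "\<dots> = (\<Oplus>\<gamma>\<in>?S. c (?h \<gamma>))"
    by (rule finsum_reindex[OF _ inj]) (use cM in auto)
  also have "\<dots> = (\<Oplus>\<gamma>\<in>?S. ?c \<gamma>)"
    by (rule finsum_cong') (use cM in auto)
  finally have "x = (\<Oplus>\<gamma>\<in>?S. ?c \<gamma>)" .
  moreover have "?c \<in> (\<Pi>\<^sub>E \<gamma>\<in>carrier G. Q' \<gamma>)" using cP P' \<beta> by auto
  ultimately show ?thesis using fin unfolding decomposition_def by blast
qed

text \<open>Existence translates the components by \<beta>; uniqueness translates a decomposition
  for \<open>P'\<close> back by the inverse and compares it with the one for \<open>P\<close>. As
  \<open>P'\<close> is prescribed only on the carrier, the restricted families of
  \<open>graded_shift\<close> are covered.\<close>

lemma (in graded_group) graded_group_shift: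
  assumes "group G" and \<beta>: "\<beta> \<in> carrier G"
    and P': "\<And>\<gamma>. \<gamma> \<in> carrier G \<Longrightarrow> P' \<gamma> = P (\<gamma> \<otimes>\<^bsub>G\<^esub> \<beta>)"
  shows "internal_direct_sum M (carrier G) P'"
    and "x \<in> carrier M \<Longrightarrow> \<gamma> \<in> carrier G \<Longrightarrow> component G M P' x \<gamma> = cmp x (\<gamma> \<otimes>\<^bsub>G\<^esub> \<beta>)"
proof -
  interpret G: group G by fact
  have P: "P \<gamma> = P' (\<gamma> \<otimes>\<^bsub>G\<^esub> inv\<^bsub>G\<^esub> \<beta>)" if "\<gamma> \<in> carrier G" for \<gamma>
    using P'[of "\<gamma> \<otimes>\<^bsub>G\<^esub> inv\<^bsub>G\<^esub> \<beta>"] that \<beta> by (simp add: G.m_assoc)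
  have P'M: "P' \<gamma> \<subseteq> carrier M" if "\<gamma> \<in> carrier G" for \<gamma>
    using P'[OF that] part_carrier[OF G.m_closed[OF that \<beta>]] by auto
  have dec: "decomposition M (carrier G) P' y (\<lambda>\<gamma>\<in>carrier G. cmp y (\<gamma> \<otimes>\<^bsub>G\<^esub> \<beta>))"
    if "y \<in> carrier M" for y
    by (rule decomposition_shift[OF assms(1) \<beta> P' _ decomposition_component[OF that]])
      (use part_carrier in auto)
  have uniq: "d = (\<lambda>\<gamma>\<in>carrier G. cmp y (\<gamma> \<otimes>\<^bsub>G\<^esub> \<beta>))"
    if y: "y \<in> carrier M" and d: "decomposition M (carrier G) P' y d" for y d
  proof -
    have "decomposition M (carrier G) P y (\<lambda>\<gamma>\<in>carrier G. d (\<gamma> \<otimes>\<^bsub>G\<^esub> inv\<^bsub>G\<^esub> \<beta>))"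
      by (rule decomposition_shift[OF assms(1) _ P P'M d]) (use \<beta> in auto)
    then have "cmp y = (\<lambda>\<gamma>\<in>carrier G. d (\<gamma> \<otimes>\<^bsub>G\<^esub> inv\<^bsub>G\<^esub> \<beta>))" by (rule component_eq[OF y])
    then have "cmp y (\<gamma> \<otimes>\<^bsub>G\<^esub> \<beta>) = d \<gamma>" if "\<gamma> \<in> carrier G" for \<gamma>
      using that \<beta> by (simp add: G.m_assoc)
    moreover have "d \<in> extensional (carrier G)" using d by (auto simp: decomposition_def PiE_def)
    ultimately show ?thesis by (intro extensionalityI[of d "carrier G"]) auto
  qed
  show ids': "internal_direct_sum M (carrier G) P'"
    unfolding internal_direct_sum_def using part_subgroup P' \<beta> dec uniq by (metis G.m_closed)
  show "component G M P' x \<gamma> = cmp x (\<gamma> \<otimes>\<^bsub>G\<^esub> \<beta>)" if "x \<in> carrier M" "\<gamma> \<in> carrier G"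
  proof -
    interpret S: graded_group G M P' by unfold_locales (rule ids')
    show ?thesis using S.component_eq[OF that(1) dec[OF that(1)]] that by simp
  qed
qed

section \<open>The action respects multiplication\<close>

context graded_left_module
begin

text \<open>By \<open>component_smult\<close>, the component of \<open>a x\<close> in degree
  \<alpha> is a component of \<open>a\<close> applied to \<open>x\<close>. The ring element in front
  of \<open>x\<close> is therefore column \<beta> of a smash product whose right factor has
  \<open>a\<close> in that column.\<close>

lemma act_smult_homogeneous:
  assumes f: "f \<in> carrier Sm" and a: "a \<in> carrier A" and \<beta>: "\<beta> \<in> carrier G" and x: "x \<in> P \<beta>"
  shows "act f (a \<odot>\<^bsub>M\<^esub> x) =
    (\<Oplus>\<^bsub>A\<^esub>\<alpha>\<in>{\<alpha> \<in> carrier G. f \<alpha> \<noteq> \<zero>\<^bsub>A\<^esub>}. f \<alpha> \<otimes>\<^bsub>A\<^esub> AC.cmp a (\<alpha> \<otimes>\<^bsub>G\<^esub> inv\<^bsub>G\<^esub> \<beta>)) \<odot>\<^bsub>M\<^esub> x"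
    (is "_ = (\<Oplus>\<^bsub>A\<^esub>\<alpha>\<in>?S. _) \<odot>\<^bsub>M\<^esub> x")
proof -
  have xM: "x \<in> carrier M" using MC.part_carrier \<beta> x by blast
  have cl: "AC.cmp a (\<alpha> \<otimes>\<^bsub>G\<^esub> inv\<^bsub>G\<^esub> \<beta>) \<in> carrier A" if "\<alpha> \<in> carrier G" for \<alpha>
    using that a \<beta> by (intro AC.component_closed) auto
  have mcl: "f \<alpha> \<otimes>\<^bsub>A\<^esub> AC.cmp a (\<alpha> \<otimes>\<^bsub>G\<^esub> inv\<^bsub>G\<^esub> \<beta>) \<in> carrier A" if "\<alpha> \<in> carrier G" for \<alpha>
    using that cl smash_value[OF f] A.m_closed by blast
  have "act f (a \<odot>\<^bsub>M\<^esub> x) = (\<Oplus>\<^bsub>M\<^esub>\<alpha>\<in>?S. (f \<alpha> \<otimes>\<^bsub>A\<^esub> AC.cmp a (\<alpha> \<otimes>\<^bsub>G\<^esub> inv\<^bsub>G\<^esub> \<beta>)) \<odot>\<^bsub>M\<^esub> x)"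
    unfolding smash_act_def
    by (rule M.finsum_cong') (use f a \<beta> x xM cl mcl smash_value in
        \<open>auto simp: component_smult smult_assoc smult_closed\<close>)
  also have "\<dots> = (\<Oplus>\<^bsub>A\<^esub>\<alpha>\<in>?S. f \<alpha> \<otimes>\<^bsub>A\<^esub> AC.cmp a (\<alpha> \<otimes>\<^bsub>G\<^esub> inv\<^bsub>G\<^esub> \<beta>)) \<odot>\<^bsub>M\<^esub> x"
    by (rule smult_finsum_left[OF xM, symmetric])
      (use mcl in auto)
  finally show ?thesis .
qed

text \<open>Both sides are additive in \<open>x\<close>, and in degree \<beta> the claim is
  \<open>act_smult_homogeneous\<close> with \<open>g \<beta>\<close> for \<open>a\<close>. That the
  product lies in the carrier is a premise because \<open>smash_mult_closed\<close> is itself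
  derived from this locale, applied to the regular module.\<close>

lemma act_mult:
  assumes f: "f \<in> carrier Sm" and g: "g \<in> carrier Sm" and fg: "f \<otimes>\<^bsub>Sm\<^esub> g \<in> carrier Sm"
    and x: "x \<in> carrier M"
  shows "act (f \<otimes>\<^bsub>Sm\<^esub> g) x = act f (act g x)"
  using x
proof (induction x rule: MC.homogeneous_induct)
  case (homogeneous \<beta> x)
  then show ?case
    using act_homogeneous[OF fg homogeneous] act_homogeneous[OF g homogeneous]
      act_smult_homogeneous[OF f smash_value[OF g] _ homogeneous(2)]
    by (simp add: smash_mult_apply smash_value[OF g])
next
  case (add x y)
  then show ?case by (simp add: act_add_right f g fg act_closed)
next
  show "carrier G \<noteq> {}" using G.one_closed by blast
qed

end

section \<open>Notions that depend only on the additive group of a record\<close>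

lemma finsum_same:
  assumes "carrier H' = carrier H" "add H' = add H" "zero H' = zero H"
  shows "finsum H' = finsum H"
  by (intro ext) (simp add: assms finsum_def finprod_def)

lemma abelian_group_same:
  assumes "carrier H' = carrier H" "add H' = add H" "zero H' = zero H"
  shows "abelian_group H' \<longleftrightarrow> abelian_group H"
  using assms by (simp add: abelian_group_def abelian_monoid_def abelian_group_axioms_def
      comm_group_def comm_monoid_def comm_monoid_axioms_def monoid_def group_def group_axioms_def
      Units_def)

lemma decomposition_same:
  assumes "carrier H' = carrier H" "add H' = add H" "zero H' = zero H"
  shows "decomposition H' I F = decomposition H I F"
  by (intro ext) (simp add: decomposition_def finsum_same[OF assms] assms(3))

lemma internal_direct_sum_same:
  assumes "carrier H' = carrier H" "add H' = add H" "zero H' = zero H"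
  shows "internal_direct_sum H' I F \<longleftrightarrow> internal_direct_sum H I F"
  by (simp add: internal_direct_sum_def subgroup_def m_inv_def decomposition_same[OF assms] assms)

lemma component_same:
  assumes "carrier H' = carrier H" "add H' = add H" "zero H' = zero H"
  shows "component G H' P = component G H P"
  by (intro ext) (simp add: component_def decomposition_same[OF assms])

text \<open>
  Multiplication in $A \#\Gamma$ computes, in the column \<open>\<beta>\<close>, the action of the left factor on \<open>A\<close>
  with the shifted grading $A(\beta^{-1})$. Hence the ring axioms of $A \#\Gamma$ are module axioms
  for the regular module.
\<close>

definition regular_module :: "('a, 'y) ring_scheme \<Rightarrow> ('a, 'a) module" where
  "regular_module A = \<lparr>carrier = carrier A, mult = mult A, one = one A, zero = zero A, add = add A,
     smult = mult A\<rparr>"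

lemma regular_module_simps [simp]:
  "carrier (regular_module A) = carrier A" "zero (regular_module A) = zero A"
  "add (regular_module A) = add A" "smult (regular_module A) = mult A"
  by (simp_all add: regular_module_def)

lemma finsum_regular_module [simp]: "finsum (regular_module A) = finsum A"
  by (rule finsum_same) simp_all

context graded_ring
begin

lemma regular_module_left_module: "left_module A (regular_module A)"
proof -
  have "abelian_group (regular_module A)"
    using abelian_group_same[of "regular_module A" A] A.abelian_group_axioms by simp
  then show ?thesis
    by (intro left_module.intro A.nonunital_ring_axioms left_module_axioms.intro)
      (auto simp: A.m_closed A.l_distr A.r_distr A.m_assoc)
qed

lemma regular_module_direct_sum: "internal_direct_sum (regular_module A) (carrier G) \<A>"
  by (subst internal_direct_sum_same[of "regular_module A" A]) (simp_all add: direct_sum)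

text \<open>Translating degrees on the right is compatible with multiplication from the left, by
  associativity of the group.\<close>

lemma graded_regular_module:
  assumes \<beta>: "\<beta> \<in> carrier G"
  shows "graded_left_module G A \<A> (regular_module A) (\<lambda>\<gamma>. \<A> (\<gamma> \<otimes>\<^bsub>G\<^esub> inv\<^bsub>G\<^esub> \<beta>))"
    and "\<lbrakk>x \<in> carrier A; \<alpha> \<in> carrier G\<rbrakk>
      \<Longrightarrow> component G (regular_module A) (\<lambda>\<gamma>. \<A> (\<gamma> \<otimes>\<^bsub>G\<^esub> inv\<^bsub>G\<^esub> \<beta>)) x \<alpha>
        = AC.cmp x (\<alpha> \<otimes>\<^bsub>G\<^esub> inv\<^bsub>G\<^esub> \<beta>)"
proof -
  interpret L: left_module A "regular_module A" by (rule regular_module_left_module)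
  interpret R: graded_group G "regular_module A" \<A>
    by unfold_locales (rule regular_module_direct_sum)
  note shift = R.graded_group_shift[OF G.group_axioms G.inv_closed[OF \<beta>] refl]
  show "graded_left_module G A \<A> (regular_module A) (\<lambda>\<gamma>. \<A> (\<gamma> \<otimes>\<^bsub>G\<^esub> inv\<^bsub>G\<^esub> \<beta>))"
    by unfold_locales (use shift(1) graded_mult \<beta> in \<open>auto simp: G.m_assoc\<close>)
  have "R.cmp = AC.cmp" by (rule component_same) simp_all
  then show "component G (regular_module A) (\<lambda>\<gamma>. \<A> (\<gamma> \<otimes>\<^bsub>G\<^esub> inv\<^bsub>G\<^esub> \<beta>)) x \<alpha>
      = AC.cmp x (\<alpha> \<otimes>\<^bsub>G\<^esub> inv\<^bsub>G\<^esub> \<beta>)" if "x \<in> carrier A" "\<alpha> \<in> carrier G"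
    using shift(2)[of x \<alpha>] that by simp
qed

lemma smash_mult_act:
  assumes f: "f \<in> carrier Sm" and g: "g \<in> carrier Sm" and \<beta>: "\<beta> \<in> carrier G"
  shows "(f \<otimes>\<^bsub>Sm\<^esub> g) \<beta> =
    smash_act G A (regular_module A) (\<lambda>\<gamma>. \<A> (\<gamma> \<otimes>\<^bsub>G\<^esub> inv\<^bsub>G\<^esub> \<beta>)) f (g \<beta>)"
  unfolding smash_act_def
  by (auto simp: smash_product_def \<beta> intro!: A.finsum_cong' A.m_closed AC.component_closed
      smash_value[OF f] smash_value[OF g] simp: graded_regular_module(2)[OF \<beta>] smash_value[OF g \<beta>])

lemma smash_mult_closed:
  assumes f: "f \<in> carrier Sm" and g: "g \<in> carrier Sm"
  shows "f \<otimes>\<^bsub>Sm\<^esub> g \<in> carrier Sm"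
proof -
  have cl: "(f \<otimes>\<^bsub>Sm\<^esub> g) \<beta> \<in> carrier A" if \<beta>: "\<beta> \<in> carrier G" for \<beta>
  proof -
    interpret R: graded_left_module G A \<A> "regular_module A" "\<lambda>\<gamma>. \<A> (\<gamma> \<otimes>\<^bsub>G\<^esub> inv\<^bsub>G\<^esub> \<beta>)"
      by (rule graded_regular_module(1)[OF \<beta>])
    show ?thesis using R.act_closed[OF f] smash_value[OF g \<beta>] by (simp add: smash_mult_act f g \<beta>)
  qed
  have zero: "(f \<otimes>\<^bsub>Sm\<^esub> g) \<beta> = \<zero>\<^bsub>A\<^esub>" if \<beta>: "\<beta> \<in> carrier G" and z: "g \<beta> = \<zero>\<^bsub>A\<^esub>" for \<beta>
  proof -
    interpret R: graded_left_module G A \<A> "regular_module A" "\<lambda>\<gamma>. \<A> (\<gamma> \<otimes>\<^bsub>G\<^esub> inv\<^bsub>G\<^esub> \<beta>)"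
      by (rule graded_regular_module(1)[OF \<beta>])
    \<comment> \<open>Zero belongs to every part, so it counts as homogeneous of degree \<beta> and
      \<open>act_homogeneous\<close> applies.\<close>
    show ?thesis
      using R.act_homogeneous[OF f \<beta> R.MC.part_zero[OF \<beta>]] smash_value[OF f \<beta>]
      by (simp add: smash_mult_act f g \<beta> z A.r_null)
  qed
  have "{\<beta> \<in> carrier G. (f \<otimes>\<^bsub>Sm\<^esub> g) \<beta> \<noteq> \<zero>\<^bsub>A\<^esub>} \<subseteq> {\<beta> \<in> carrier G. g \<beta> \<noteq> \<zero>\<^bsub>A\<^esub>}"
    using zero by auto
  then have "finite {\<beta> \<in> carrier G. (f \<otimes>\<^bsub>Sm\<^esub> g) \<beta> \<noteq> \<zero>\<^bsub>A\<^esub>}"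
    by (rule finite_subset) (rule smash_finite[OF g])
  moreover have "f \<otimes>\<^bsub>Sm\<^esub> g \<in> extensional (carrier G)" by (simp add: smash_product_def)
  ultimately show ?thesis using cl by (auto simp: smash_carrier PiE_def)
qed

lemma smash_nonunital_ring: "nonunital_ring Sm"
proof (intro nonunital_ring.intro nonunital_ring_axioms.intro smash_abelian_group)
  fix f g h assume f: "f \<in> carrier Sm" and g: "g \<in> carrier Sm" and h: "h \<in> carrier Sm"
  note closed = smash_mult_closed smash_add_closed f g h
  show "f \<otimes>\<^bsub>Sm\<^esub> g \<in> carrier Sm" by (simp add: closed)
  have *: "((f \<otimes>\<^bsub>Sm\<^esub> g) \<otimes>\<^bsub>Sm\<^esub> h) \<beta> = (f \<otimes>\<^bsub>Sm\<^esub> (g \<otimes>\<^bsub>Sm\<^esub> h)) \<beta> \<and>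
      ((f \<oplus>\<^bsub>Sm\<^esub> g) \<otimes>\<^bsub>Sm\<^esub> h) \<beta> = ((f \<otimes>\<^bsub>Sm\<^esub> h) \<oplus>\<^bsub>Sm\<^esub> (g \<otimes>\<^bsub>Sm\<^esub> h)) \<beta> \<and>
      (h \<otimes>\<^bsub>Sm\<^esub> (f \<oplus>\<^bsub>Sm\<^esub> g)) \<beta> = ((h \<otimes>\<^bsub>Sm\<^esub> f) \<oplus>\<^bsub>Sm\<^esub> (h \<otimes>\<^bsub>Sm\<^esub> g)) \<beta>"
    if \<beta>: "\<beta> \<in> carrier G" for \<beta>
  proof -
    interpret R: graded_left_module G A \<A> "regular_module A" "\<lambda>\<gamma>. \<A> (\<gamma> \<otimes>\<^bsub>G\<^esub> inv\<^bsub>G\<^esub> \<beta>)"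
      by (rule graded_regular_module(1)[OF \<beta>])
    show ?thesis
      using R.act_mult[OF f g, of "h \<beta>"] R.act_add_left[OF f g, of "h \<beta>"]
        R.act_add_right[OF h, of "f \<beta>" "g \<beta>"]
      by (simp add: smash_mult_act closed \<beta> smash_value smash_add)
  qed
  show "(f \<otimes>\<^bsub>Sm\<^esub> g) \<otimes>\<^bsub>Sm\<^esub> h = f \<otimes>\<^bsub>Sm\<^esub> (g \<otimes>\<^bsub>Sm\<^esub> h)"
    by (rule smash_ext) (simp_all add: closed *)
  show "(f \<oplus>\<^bsub>Sm\<^esub> g) \<otimes>\<^bsub>Sm\<^esub> h = (f \<otimes>\<^bsub>Sm\<^esub> h) \<oplus>\<^bsub>Sm\<^esub> (g \<otimes>\<^bsub>Sm\<^esub> h)"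
    by (rule smash_ext) (simp_all add: closed *)
  show "h \<otimes>\<^bsub>Sm\<^esub> (f \<oplus>\<^bsub>Sm\<^esub> g) = (h \<otimes>\<^bsub>Sm\<^esub> f) \<oplus>\<^bsub>Sm\<^esub> (h \<otimes>\<^bsub>Sm\<^esub> g)"
    by (rule smash_ext) (simp_all add: closed *)
qed

text \<open>The last premise says that \<open>F\<close> covers the degrees of
  \<open>f \<beta>\<close> in the grading shifted by the inverse of \<beta>. Then the slice acts on
  this column as \<open>a\<close>, by \<open>act_slice_superset\<close>.\<close>

lemma slice_mult_apply:
  assumes "a \<in> carrier A" "f \<in> carrier Sm" and F: "finite F" "F \<subseteq> carrier G" and \<beta>: "\<beta> \<in> carrier G"
    and "\<And>\<alpha>. \<alpha> \<in> carrier G \<Longrightarrow> AC.cmp (f \<beta>) (\<alpha> \<otimes>\<^bsub>G\<^esub> inv\<^bsub>G\<^esub> \<beta>) \<noteq> \<zero>\<^bsub>A\<^esub> \<Longrightarrow> \<alpha> \<in> F"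
  shows "(slice G A a F \<otimes>\<^bsub>Sm\<^esub> f) \<beta> = a \<otimes>\<^bsub>A\<^esub> f \<beta>"
proof -
  interpret R: graded_left_module G A \<A> "regular_module A" "\<lambda>\<gamma>. \<A> (\<gamma> \<otimes>\<^bsub>G\<^esub> inv\<^bsub>G\<^esub> \<beta>)"
    by (rule graded_regular_module(1)[OF \<beta>])
  show ?thesis
    using assms R.act_slice_superset[of a "f \<beta>" F]
    by (simp add: smash_mult_act slice_closed smash_value graded_regular_module(2)[OF \<beta>])
qed

text \<open>As \<open>e\<close> has degree \<epsilon>, it has degree \<beta> in the grading that
  belongs to column \<beta>; hence only the coefficient \<open>f \<beta>\<close> meets it. Unlike
  for a slice on the left, \<open>F\<close> may be any finite set.\<close>

lemma mult_slice_one_apply: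
  assumes f: "f \<in> carrier Sm" and e: "e \<in> \<A> \<one>\<^bsub>G\<^esub>" and F: "finite F" and \<beta>: "\<beta> \<in> carrier G"
  shows "(f \<otimes>\<^bsub>Sm\<^esub> slice G A e F) \<beta> = (if \<beta> \<in> F then f \<beta> \<otimes>\<^bsub>A\<^esub> e else \<zero>\<^bsub>A\<^esub>)"
proof -
  interpret R: graded_left_module G A \<A> "regular_module A" "\<lambda>\<gamma>. \<A> (\<gamma> \<otimes>\<^bsub>G\<^esub> inv\<^bsub>G\<^esub> \<beta>)"
    by (rule graded_regular_module(1)[OF \<beta>])
  have eA: "e \<in> carrier A" using e AC.part_carrier by blast
  have "slice G A e F \<beta> \<in> \<A> (\<beta> \<otimes>\<^bsub>G\<^esub> inv\<^bsub>G\<^esub> \<beta>)"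
    using e \<beta> AC.part_zero by (simp add: slice_apply)
  then show ?thesis
    using R.act_homogeneous[OF f \<beta>] smash_value[OF f \<beta>]
    by (simp add: smash_mult_act f eA F \<beta> slice_closed) (simp add: slice_apply \<beta> A.r_null)
qed

end

section \<open>Local units\<close>

lemma (in left_module) unital_moduleI:
  assumes "\<And>x. x \<in> carrier M \<Longrightarrow> \<exists>b\<in>carrier B. b \<odot>\<^bsub>M\<^esub> x = x"
  shows "unital_module B M"
proof unfold_locales
  let ?H = "{b \<odot>\<^bsub>M\<^esub> x |b x. b \<in> carrier B \<and> x \<in> carrier M}"
  have "?H \<subseteq> carrier M" using smult_closed by auto
  then have "generate (add_monoid M) ?H \<subseteq> carrier M" using M.add.generate_incl by auto
  moreover have "carrier M \<subseteq> generate (add_monoid M) ?H"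
  proof
    fix x assume x: "x \<in> carrier M"
    then obtain b where "b \<in> carrier B" "b \<odot>\<^bsub>M\<^esub> x = x" using assms by blast
    then have "x \<in> ?H" using x by force
    then show "x \<in> generate (add_monoid M) ?H" by (rule generate.incl)
  qed
  ultimately show "generate (add_monoid M) ?H = carrier M" by blast
qed

lemma (in left_module) smult_minus:
  assumes "a \<in> carrier B" "x \<in> carrier M"
  shows "a \<odot>\<^bsub>M\<^esub> (\<ominus>\<^bsub>M\<^esub> x) = \<ominus>\<^bsub>M\<^esub> (a \<odot>\<^bsub>M\<^esub> x)"
proof -
  have "a \<odot>\<^bsub>M\<^esub> (\<ominus>\<^bsub>M\<^esub> x) \<oplus>\<^bsub>M\<^esub> a \<odot>\<^bsub>M\<^esub> x = a \<odot>\<^bsub>M\<^esub> (\<ominus>\<^bsub>M\<^esub> x \<oplus>\<^bsub>M\<^esub> x)"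
    using assms by (simp add: smult_r_distr)
  also have "\<dots> = \<zero>\<^bsub>M\<^esub>" using assms by (simp add: M.l_neg smult_r_null)
  finally show ?thesis using assms by (metis M.minus_equality smult_closed M.a_inv_closed)
qed

text \<open>The inverse of a generator \<open>b y\<close> is the generator \<open>b (-y)\<close>, so
  the subgroup generated by the products consists of their sums and the induction has no case for
  inverses.\<close>

lemma (in unital_module) unital_induct [consumes 1, case_names smult add]:
  assumes "x \<in> carrier M"
    and smult: "\<And>b x. b \<in> carrier B \<Longrightarrow> x \<in> carrier M \<Longrightarrow> Q (b \<odot>\<^bsub>M\<^esub> x)"
    and add: "\<And>x y. x \<in> carrier M \<Longrightarrow> y \<in> carrier M \<Longrightarrow> Q x \<Longrightarrow> Q y \<Longrightarrow> Q (x \<oplus>\<^bsub>M\<^esub> y)"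
  shows "Q x"
proof -
  have "x \<in> generate (add_monoid M) {b \<odot>\<^bsub>M\<^esub> x |b x. b \<in> carrier B \<and> x \<in> carrier M}"
    using assms(1) unital by simp
  then show ?thesis
  proof (induction rule: generate.induct)
    case one
    then show ?case
      using smult[OF B.zero_closed M.zero_closed] by (simp add: smult_r_null)
  next
    case (incl h)
    then show ?case using smult by auto
  next
    case (inv h)
    then obtain b y where h: "h = b \<odot>\<^bsub>M\<^esub> y" "b \<in> carrier B" "y \<in> carrier M" by auto
    then have "\<ominus>\<^bsub>M\<^esub> h = b \<odot>\<^bsub>M\<^esub> (\<ominus>\<^bsub>M\<^esub> y)" by (simp add: smult_minus)
    then have "Q (\<ominus>\<^bsub>M\<^esub> h)" using smult h by simp
    then show ?case by (simp add: a_inv_def)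
  next
    case (eng h1 h2)
    then show ?case using add unital by simp
  qed
qed

section \<open>Homogeneous idempotents and products of slices\<close>

definition idempotents_one ::
  "('g, 'x) monoid_scheme \<Rightarrow> ('a, 'y) ring_scheme \<Rightarrow> ('g \<Rightarrow> 'a set) \<Rightarrow> 'a set" where
  "idempotents_one G A \<A> = {e \<in> \<A> \<one>\<^bsub>G\<^esub>. e \<otimes>\<^bsub>A\<^esub> e = e}"

context graded_ring
begin

abbreviation "Idp \<equiv> idempotents_one G A \<A>"

lemma Idp_part: "e \<in> Idp \<Longrightarrow> e \<in> \<A> \<one>\<^bsub>G\<^esub>"
  by (simp add: idempotents_one_def)

lemma Idp_closed: "e \<in> Idp \<Longrightarrow> e \<in> carrier A"
  using Idp_part AC.part_carrier by blast

lemma Idp_idem: "e \<in> Idp \<Longrightarrow> e \<otimes>\<^bsub>A\<^esub> e = e"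
  by (simp add: idempotents_one_def)

text \<open>\<open>e = e e\<close> lies in the parts of degrees \<gamma> and \<gamma>\<gamma>.
  Distinct parts meet only in zero, so either \<gamma>\<gamma> = \<gamma>, or \<open>e\<close> is
  zero, which lies in every part.\<close>

lemma homogeneous_idempotent_degree:
  assumes "e \<in> homogeneous G \<A>" "e \<otimes>\<^bsub>A\<^esub> e = e" shows "e \<in> Idp"
proof -
  obtain \<gamma> where \<gamma>: "\<gamma> \<in> carrier G" "e \<in> \<A> \<gamma>" using assms(1) by (auto simp: homogeneous_def)
  have \<gamma>2: "e \<in> \<A> (\<gamma> \<otimes>\<^bsub>G\<^esub> \<gamma>)" using graded_mult[OF \<gamma>(1,1,2,2)] assms(2) by simp
  have "e = \<zero>\<^bsub>A\<^esub> \<or> \<gamma> \<otimes>\<^bsub>G\<^esub> \<gamma> = \<gamma>"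
    using AC.component_homogeneous[OF \<gamma> \<gamma>(1)] AC.component_homogeneous[OF _ \<gamma>2 \<gamma>(1)] \<gamma>(1) by auto
  then have "e \<in> \<A> \<one>\<^bsub>G\<^esub>" using \<gamma> AC.part_zero G.r_cancel_one by fastforce
  then show ?thesis using assms(2) by (simp add: idempotents_one_def)
qed

text \<open>The left slice multiplies the columns by \<open>a\<close> as soon as \<open>F'\<close>
  contains \<delta>\<beta> for each degree \<delta> of \<open>b\<close> and each \<beta> in
  \<open>F\<close>; the last premise says this with \<alpha> = \<delta>\<beta>.\<close>

lemma slice_mult_slice:
  assumes "a \<in> carrier A" "b \<in> carrier A" "finite F'" "F' \<subseteq> carrier G" "finite F" "F \<subseteq> carrier G"
    and "\<And>\<alpha> \<beta>. \<alpha> \<in> carrier G \<Longrightarrow> \<beta> \<in> F \<Longrightarrow> AC.cmp b (\<alpha> \<otimes>\<^bsub>G\<^esub> inv\<^bsub>G\<^esub> \<beta>) \<noteq> \<zero>\<^bsub>A\<^esub> \<Longrightarrow> \<alpha> \<in> F'"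
  shows "slice G A a F' \<otimes>\<^bsub>Sm\<^esub> slice G A b F = slice G A (a \<otimes>\<^bsub>A\<^esub> b) F"
proof (rule smash_ext)
  fix \<beta> assume \<beta>: "\<beta> \<in> carrier G"
  have "(slice G A a F' \<otimes>\<^bsub>Sm\<^esub> slice G A b F) \<beta> = a \<otimes>\<^bsub>A\<^esub> slice G A b F \<beta>"
    by (rule slice_mult_apply) (use assms \<beta> slice_closed in
        \<open>auto simp: slice_apply AC.component_zero split: if_splits\<close>)
  then show "(slice G A a F' \<otimes>\<^bsub>Sm\<^esub> slice G A b F) \<beta> = slice G A (a \<otimes>\<^bsub>A\<^esub> b) F \<beta>"
    using \<beta> assms by (simp add: slice_apply A.r_null)
qed (use assms in \<open>auto intro!: smash_mult_closed slice_closed A.m_closed\<close>)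

lemma slice_mult_slice_one:
  assumes "a \<in> carrier A" "e \<in> \<A> \<one>\<^bsub>G\<^esub>" "finite F'" "finite F"
  shows "slice G A a F' \<otimes>\<^bsub>Sm\<^esub> slice G A e F = slice G A (a \<otimes>\<^bsub>A\<^esub> e) (F \<inter> F')"
proof -
  have e: "e \<in> carrier A" using assms(2) AC.part_carrier by blast
  show ?thesis
    by (rule smash_ext) (use assms e in \<open>auto intro!: smash_mult_closed slice_closed A.m_closed
        simp: mult_slice_one_apply slice_closed slice_apply A.l_null\<close>)
qed

lemma slice_add:
  "\<lbrakk>a \<in> carrier A; b \<in> carrier A; finite F\<rbrakk>
    \<Longrightarrow> slice G A (a \<oplus>\<^bsub>A\<^esub> b) F = slice G A a F \<oplus>\<^bsub>Sm\<^esub> slice G A b F"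
  by (rule smash_ext) (auto intro!: slice_closed smash_add_closed simp: smash_add slice_apply)

lemma slice_empty: "slice G A a {} = \<zero>\<^bsub>Sm\<^esub>"
  by (auto simp: slice_def smash_product_def)

lemma sum_slices:
  assumes f: "f \<in> carrier Sm" and F: "finite F" "F \<subseteq> carrier G"
    and sup: "\<And>\<gamma>. \<gamma> \<in> carrier G - F \<Longrightarrow> f \<gamma> = \<zero>\<^bsub>A\<^esub>"
  shows "(\<Oplus>\<^bsub>Sm\<^esub>\<gamma>\<in>F. slice G A (f \<gamma>) {\<gamma>}) = f"
proof -
  interpret S: abelian_group Sm by (rule smash_abelian_group)
  have cl: "(\<lambda>\<gamma>. slice G A (f \<gamma>) {\<gamma>}) \<in> F \<rightarrow> carrier Sm"
    using F smash_value[OF f] by (auto intro!: slice_closed)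
  have "(\<Oplus>\<^bsub>Sm\<^esub>\<gamma>\<in>F. slice G A (f \<gamma>) {\<gamma>}) \<beta> = f \<beta>" if \<beta>: "\<beta> \<in> carrier G" for \<beta>
  proof -
    have "(\<Oplus>\<^bsub>Sm\<^esub>\<gamma>\<in>F. slice G A (f \<gamma>) {\<gamma>}) \<beta> = (\<Oplus>\<^bsub>A\<^esub>\<gamma>\<in>F. slice G A (f \<gamma>) {\<gamma>} \<beta>)"
      \<comment> \<open>Evaluation at \<beta> is additive, so it passes under the sum.\<close>
      by (rule additive_finsum[where h = "\<lambda>g. g \<beta>", OF _ _ _ _ cl])
        (use \<beta> in \<open>auto simp: smash_abelian_group A.abelian_group_axioms smash_add smash_value\<close>)
    also have "\<dots> = (\<Oplus>\<^bsub>A\<^esub>\<gamma>\<in>F. if \<beta> = \<gamma> then f \<gamma> else \<zero>\<^bsub>A\<^esub>)"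
      by (rule A.finsum_cong') (use \<beta> F smash_value[OF f] in \<open>auto simp: slice_apply\<close>)
    also have "\<dots> = f \<beta>"
    proof (cases "\<beta> \<in> F")
      case True
      then show ?thesis using F smash_value[OF f] by (intro A.finsum_singleton) auto
    next
      case False
      then have "(\<Oplus>\<^bsub>A\<^esub>\<gamma>\<in>F. if \<beta> = \<gamma> then f \<gamma> else \<zero>\<^bsub>A\<^esub>) = (\<Oplus>\<^bsub>A\<^esub>\<gamma>\<in>F. \<zero>\<^bsub>A\<^esub>)"
        by (intro A.finsum_cong') auto
      then show ?thesis using False sup \<beta> by (simp add: A.finsum_zero)
    qed
    finally show ?thesis .
  qed
  then show ?thesis using f cl by (intro smash_ext S.finsum_closed) auto
qed

text \<open>Only finitely many columns \<beta> are nonzero and each has finitely many degrees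
  \<delta>; the condition on \<alpha> forces \<alpha> = \<delta>\<beta> for one of these pairs. The
  set \<open>F\<close> is what \<open>slice_mult_apply\<close> asks for, for all columns at
  once.\<close>

lemma left_support:
  assumes f: "f \<in> carrier Sm"
  obtains F where "finite F" "F \<subseteq> carrier G"
    "\<And>\<alpha> \<beta>. \<alpha> \<in> carrier G \<Longrightarrow> \<beta> \<in> carrier G \<Longrightarrow> AC.cmp (f \<beta>) (\<alpha> \<otimes>\<^bsub>G\<^esub> inv\<^bsub>G\<^esub> \<beta>) \<noteq> \<zero>\<^bsub>A\<^esub> \<Longrightarrow> \<alpha> \<in> F"
proof
  let ?S = "\<lambda>\<beta>. {\<delta> \<in> carrier G. AC.cmp (f \<beta>) \<delta> \<noteq> \<zero>\<^bsub>A\<^esub>}"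
  let ?F = "\<Union>\<beta>\<in>{\<beta> \<in> carrier G. f \<beta> \<noteq> \<zero>\<^bsub>A\<^esub>}. (\<lambda>\<delta>. \<delta> \<otimes>\<^bsub>G\<^esub> \<beta>) ` ?S \<beta>"
  show "finite ?F" using smash_finite[OF f] smash_value[OF f] AC.finite_component by blast
  show "?F \<subseteq> carrier G" by auto
  fix \<alpha> \<beta> assume \<alpha>: "\<alpha> \<in> carrier G" and \<beta>: "\<beta> \<in> carrier G"
    and ne: "AC.cmp (f \<beta>) (\<alpha> \<otimes>\<^bsub>G\<^esub> inv\<^bsub>G\<^esub> \<beta>) \<noteq> \<zero>\<^bsub>A\<^esub>"
  have "f \<beta> \<noteq> \<zero>\<^bsub>A\<^esub>" using ne AC.component_zero \<alpha> \<beta> by auto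
  moreover have "\<alpha> = (\<alpha> \<otimes>\<^bsub>G\<^esub> inv\<^bsub>G\<^esub> \<beta>) \<otimes>\<^bsub>G\<^esub> \<beta>" using \<alpha> \<beta> by (simp add: G.m_assoc)
  ultimately show "\<alpha> \<in> ?F" using \<alpha> \<beta> ne by blast
qed

end

locale locally_unital_graded_ring = graded_ring G A \<A>
  for G :: "('g, 'x) monoid_scheme" and A :: "('a, 'y) ring_scheme" and \<A> :: "'g \<Rightarrow> 'a set" +
  assumes local_units: "graded_local_units G A \<A>"
begin

text \<open>\<open>graded_local_units\<close> speaks of homogeneous elements. It is applied to the
  nonzero components of all elements of \<open>S\<close>; multiplication by \<open>e\<close> is
  additive, so what it fixes is closed under sums.\<close>

lemma ex_local_unit:
  assumes "finite S" "S \<subseteq> carrier A"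
  obtains e where "e \<in> Idp" "\<And>s. s \<in> S \<Longrightarrow> e \<otimes>\<^bsub>A\<^esub> s = s" "\<And>s. s \<in> S \<Longrightarrow> s \<otimes>\<^bsub>A\<^esub> e = s"
proof -
  define T where "T = (\<Union>s\<in>S. AC.cmp s ` {\<gamma> \<in> carrier G. AC.cmp s \<gamma> \<noteq> \<zero>\<^bsub>A\<^esub>})"
  have "finite T" unfolding T_def using assms AC.finite_component by blast
  moreover have "T \<subseteq> homogeneous G \<A>"
    using assms(2) AC.component_part by (auto simp: homogeneous_def T_def)
  ultimately have "\<exists>e\<in>homogeneous G \<A>. e \<otimes>\<^bsub>A\<^esub> e = e \<and>
      T \<subseteq> {e \<otimes>\<^bsub>A\<^esub> a \<otimes>\<^bsub>A\<^esub> e |a. a \<in> carrier A}"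
    using local_units unfolding graded_local_units_def by blast
  then obtain e where e: "e \<in> homogeneous G \<A>" "e \<otimes>\<^bsub>A\<^esub> e = e"
    and T: "T \<subseteq> {e \<otimes>\<^bsub>A\<^esub> a \<otimes>\<^bsub>A\<^esub> e |a. a \<in> carrier A}" by blast
  have eI: "e \<in> Idp" using e by (rule homogeneous_idempotent_degree)
  then have eA: "e \<in> carrier A" by (rule Idp_closed)
  have T': "e \<otimes>\<^bsub>A\<^esub> t = t \<and> t \<otimes>\<^bsub>A\<^esub> e = t" if t: "t \<in> T" for t
  proof -
    obtain a where a: "a \<in> carrier A" "t = e \<otimes>\<^bsub>A\<^esub> a \<otimes>\<^bsub>A\<^esub> e" using subsetD[OF T t] by auto
    have "e \<otimes>\<^bsub>A\<^esub> t = (e \<otimes>\<^bsub>A\<^esub> e) \<otimes>\<^bsub>A\<^esub> a \<otimes>\<^bsub>A\<^esub> e" using a eA by (simp add: A.m_assoc A.m_closed)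
    moreover have "t \<otimes>\<^bsub>A\<^esub> e = e \<otimes>\<^bsub>A\<^esub> a \<otimes>\<^bsub>A\<^esub> (e \<otimes>\<^bsub>A\<^esub> e)"
      unfolding a(2) using a(1) eA by (simp only: A.m_assoc A.m_closed)
    ultimately show ?thesis using a(2) e(2) by simp
  qed
  \<comment> \<open>An arbitrary additive \<open>h\<close>, to be used for multiplication by
    \<open>e\<close> from either side.\<close>
  have "h s = s" if s: "s \<in> S" and h: "h \<in> carrier A \<rightarrow> carrier A"
    "\<And>x y. x \<in> carrier A \<Longrightarrow> y \<in> carrier A \<Longrightarrow> h (x \<oplus>\<^bsub>A\<^esub> y) = h x \<oplus>\<^bsub>A\<^esub> h y"
    "\<And>t. t \<in> T \<Longrightarrow> h t = t" for h s
  proof -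
    let ?F = "{\<gamma> \<in> carrier G. AC.cmp s \<gamma> \<noteq> \<zero>\<^bsub>A\<^esub>}"
    have sA: "s \<in> carrier A" using s assms by auto
    have cl: "AC.cmp s \<in> ?F \<rightarrow> carrier A" using AC.component_closed sA by auto
    have "h (\<Oplus>\<^bsub>A\<^esub>\<gamma>\<in>?F. AC.cmp s \<gamma>) = (\<Oplus>\<^bsub>A\<^esub>\<gamma>\<in>?F. h (AC.cmp s \<gamma>))"
      by (rule additive_finsum[OF A.abelian_group_axioms A.abelian_group_axioms h(1,2) cl])
    also have "\<dots> = (\<Oplus>\<^bsub>A\<^esub>\<gamma>\<in>?F. AC.cmp s \<gamma>)"
      by (rule A.finsum_cong') (use cl h(3) s in \<open>auto simp: T_def\<close>)
    finally show ?thesis by (simp only: AC.component_sum[OF sA, symmetric])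
  qed
  note fixed = this
  have "e \<otimes>\<^bsub>A\<^esub> s = s" if "s \<in> S" for s
    by (rule fixed[of s "\<lambda>x. e \<otimes>\<^bsub>A\<^esub> x"]) (use that T' eA in \<open>simp_all add: A.m_closed A.r_distr\<close>)
  moreover have "s \<otimes>\<^bsub>A\<^esub> e = s" if "s \<in> S" for s
    by (rule fixed[of s "\<lambda>x. x \<otimes>\<^bsub>A\<^esub> e"]) (use that T' eA in \<open>simp_all add: A.m_closed A.l_distr\<close>)
  ultimately show thesis using eI that by blast
qed

end

section \<open>From modules over the smash product to graded modules\<close>

text \<open>In terms of the grading still to be constructed, all components of \<open>x\<close>
  outside \<open>F\<close> vanish. It is expressed by the action alone, and the idempotent is
  quantified away because \<open>base_smult\<close> needs only the set.\<close>

definition supports ::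
  "('g, 'x) monoid_scheme \<Rightarrow> ('a, 'y) ring_scheme \<Rightarrow> ('g \<Rightarrow> 'a set) \<Rightarrow> ('g \<Rightarrow> 'a, 'm, 'z) module_scheme
    \<Rightarrow> 'g set \<Rightarrow> 'm \<Rightarrow> bool" where
  "supports G A \<A> N F x \<longleftrightarrow> finite F \<and> F \<subseteq> carrier G \<and>
    (\<exists>e\<in>idempotents_one G A \<A>. slice G A e F \<odot>\<^bsub>N\<^esub> x = x)"

text \<open>
  The product \<open>a x\<close> is recovered as $(\sum_{\gamma\in F} a p_\gamma) x$ for a finite set \<open>F\<close> that is
  large enough for \<open>x\<close>; lemma \<open>base_smult_eq\<close> shows that the chosen \<open>F\<close> does not matter.
\<close>

definition base_smult ::
  "('g, 'x) monoid_scheme \<Rightarrow> ('a, 'y) ring_scheme \<Rightarrow> ('g \<Rightarrow> 'a set) \<Rightarrow> ('g \<Rightarrow> 'a, 'm, 'z) module_scheme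
    \<Rightarrow> 'a \<Rightarrow> 'm \<Rightarrow> 'm" where
  "base_smult G A \<A> N a x = slice G A a (SOME F. supports G A \<A> N F x) \<odot>\<^bsub>N\<^esub> x"

text \<open>The union of the subgroups \<open>e p_\<gamma> N\<close> over the idempotents
  \<open>e\<close>. It is closed under addition because two such idempotents have a common left unit
  of the same kind.\<close>

definition base_part ::
  "('g, 'x) monoid_scheme \<Rightarrow> ('a, 'y) ring_scheme \<Rightarrow> ('g \<Rightarrow> 'a set) \<Rightarrow> ('g \<Rightarrow> 'a, 'm, 'z) module_scheme
    \<Rightarrow> 'g \<Rightarrow> 'm set" where
  "base_part G A \<A> N \<gamma> = {x \<in> carrier N. supports G A \<A> N {\<gamma>} x}"

locale smash_module = locally_unital_graded_ring G A \<A> + unital_module "smash_product G A \<A>" N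
  for G :: "('g, 'x) monoid_scheme" and A :: "('a, 'y) ring_scheme" and \<A> :: "'g \<Rightarrow> 'a set"
    and N :: "('g \<Rightarrow> 'a, 'm, 'z) module_scheme"
begin

lemma slice_smult_closed:
  "\<lbrakk>a \<in> carrier A; finite F; x \<in> carrier N\<rbrakk> \<Longrightarrow> slice G A a F \<odot>\<^bsub>N\<^esub> x \<in> carrier N"
  by (simp add: smult_closed slice_closed)

text \<open>Writing \<open>x\<close> as \<open>slice G A e F\<close> times \<open>x\<close> lets
  every slice act through its product with that one, where the right factor cuts the index set down.
  The independence of the choices of \<open>e\<close> and \<open>F\<close> is drawn from
  this.\<close>

lemma slice_slice_one:
  assumes "a \<in> carrier A" "e \<in> Idp" "finite F'" "finite F" "x \<in> carrier N" "slice G A e F \<odot>\<^bsub>N\<^esub> x = x"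
  shows "slice G A a F' \<odot>\<^bsub>N\<^esub> x = slice G A (a \<otimes>\<^bsub>A\<^esub> e) (F \<inter> F') \<odot>\<^bsub>N\<^esub> x"
proof -
  have "slice G A a F' \<odot>\<^bsub>N\<^esub> x = slice G A a F' \<odot>\<^bsub>N\<^esub> (slice G A e F \<odot>\<^bsub>N\<^esub> x)" by (simp add: assms)
  also have "\<dots> = (slice G A a F' \<otimes>\<^bsub>Sm\<^esub> slice G A e F) \<odot>\<^bsub>N\<^esub> x"
    using assms by (simp add: smult_assoc slice_closed Idp_closed)
  finally show ?thesis using assms by (simp add: slice_mult_slice_one Idp_part)
qed

text \<open>Together with \<open>ex_local_unit\<close>, this makes the pairs of an idempotent and a
  finite set directed, so that finitely many elements can share one pair.\<close>

lemma fixed_mono: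
  assumes "e \<in> Idp" "finite F" "x \<in> carrier N" "slice G A e F \<odot>\<^bsub>N\<^esub> x = x"
    and "e' \<in> Idp" "e' \<otimes>\<^bsub>A\<^esub> e = e" "finite F'" "F \<subseteq> F'"
  shows "slice G A e' F' \<odot>\<^bsub>N\<^esub> x = x"
proof -
  have "F \<inter> F' = F" using assms by blast
  then show ?thesis using assms slice_slice_one[of e' e F' F x] by (simp add: Idp_closed)
qed

text \<open>A product \<open>f y\<close> is fixed by any left unit of \<open>f\<close>. One is built
  from \<open>F\<close> given by \<open>left_support\<close> and a left unit \<open>e\<close> for
  the finitely many nonzero values of \<open>f\<close>. For a sum, the pairs of the two summands are
  dominated by a common one.\<close>

lemma ex_fixed:
  assumes "x \<in> carrier N"
  shows "\<exists>e F. e \<in> Idp \<and> finite F \<and> F \<subseteq> carrier G \<and> slice G A e F \<odot>\<^bsub>N\<^esub> x = x"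
  using assms
proof (induction x rule: unital_induct)
  case (smult f x)
  obtain F where F: "finite F" "F \<subseteq> carrier G" "\<And>\<alpha> \<beta>. \<alpha> \<in> carrier G \<Longrightarrow> \<beta> \<in> carrier G \<Longrightarrow>
      AC.cmp (f \<beta>) (\<alpha> \<otimes>\<^bsub>G\<^esub> inv\<^bsub>G\<^esub> \<beta>) \<noteq> \<zero>\<^bsub>A\<^esub> \<Longrightarrow> \<alpha> \<in> F"
    using left_support[OF smult(1)] by metis
  let ?V = "f ` {\<beta> \<in> carrier G. f \<beta> \<noteq> \<zero>\<^bsub>A\<^esub>}"
  have "finite ?V" "?V \<subseteq> carrier A" using smash_finite smash_value smult(1) by auto
  then obtain e where e: "e \<in> Idp" "\<And>s. s \<in> ?V \<Longrightarrow> e \<otimes>\<^bsub>A\<^esub> s = s"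
    using ex_local_unit by metis
  have eA: "e \<in> carrier A" using e Idp_closed by blast
  have ef: "e \<otimes>\<^bsub>A\<^esub> f \<beta> = f \<beta>" if "\<beta> \<in> carrier G" for \<beta>
    using that e(2) A.r_null[OF eA] by (cases "f \<beta> = \<zero>\<^bsub>A\<^esub>") auto
  have "slice G A e F \<otimes>\<^bsub>Sm\<^esub> f = f"
    by (rule smash_ext) (use F eA smult(1) ef slice_mult_apply[OF eA smult(1) F(1,2)] in
        \<open>auto simp: smash_mult_closed slice_closed\<close>)
  then have "slice G A e F \<odot>\<^bsub>N\<^esub> (f \<odot>\<^bsub>N\<^esub> x) = f \<odot>\<^bsub>N\<^esub> x"
    using smult F eA by (metis smult_assoc slice_closed)
  then show ?case using e F by blast
next
  case (add x y)
  obtain e1 F1 where 1: "e1 \<in> Idp" "finite F1" "F1 \<subseteq> carrier G" "slice G A e1 F1 \<odot>\<^bsub>N\<^esub> x = x"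
    using add by blast
  obtain e2 F2 where 2: "e2 \<in> Idp" "finite F2" "F2 \<subseteq> carrier G" "slice G A e2 F2 \<odot>\<^bsub>N\<^esub> y = y"
    using add by blast
  obtain e where e: "e \<in> Idp" "\<And>s. s \<in> {e1, e2} \<Longrightarrow> e \<otimes>\<^bsub>A\<^esub> s = s"
    using ex_local_unit[of "{e1, e2}"] 1 2 Idp_closed by (metis finite.simps empty_subsetI insert_subset)
  have "slice G A e (F1 \<union> F2) \<odot>\<^bsub>N\<^esub> x = x"
    by (rule fixed_mono[of e1 F1]) (use 1 2 e add in auto)
  moreover have "slice G A e (F1 \<union> F2) \<odot>\<^bsub>N\<^esub> y = y"
    by (rule fixed_mono[of e2 F2]) (use 1 2 e add in auto)
  ultimately have "slice G A e (F1 \<union> F2) \<odot>\<^bsub>N\<^esub> (x \<oplus>\<^bsub>N\<^esub> y) = x \<oplus>\<^bsub>N\<^esub> y"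
    using add 1 2 e Idp_closed by (simp add: smult_r_distr slice_closed)
  moreover have "finite (F1 \<union> F2)" "F1 \<union> F2 \<subseteq> carrier G" using 1 2 by auto
  ultimately show ?case using e(1) by blast
qed

lemma ex_common_fixed:
  assumes "finite X" "X \<subseteq> carrier N" "finite S" "S \<subseteq> carrier A" "finite F0" "F0 \<subseteq> carrier G"
  obtains e F where "e \<in> Idp" "finite F" "F \<subseteq> carrier G" "F0 \<subseteq> F"
    "\<And>x. x \<in> X \<Longrightarrow> slice G A e F \<odot>\<^bsub>N\<^esub> x = x" "\<And>s. s \<in> S \<Longrightarrow> e \<otimes>\<^bsub>A\<^esub> s = s"
proof -
  have "\<forall>x\<in>X. \<exists>e F. e \<in> Idp \<and> finite F \<and> F \<subseteq> carrier G \<and> slice G A e F \<odot>\<^bsub>N\<^esub> x = x"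
    using ex_fixed assms(2) by blast
  then obtain \<epsilon> \<Phi> where *: "\<And>x. x \<in> X \<Longrightarrow> \<epsilon> x \<in> Idp \<and> finite (\<Phi> x) \<and> \<Phi> x \<subseteq> carrier G \<and>
      slice G A (\<epsilon> x) (\<Phi> x) \<odot>\<^bsub>N\<^esub> x = x" by metis
  let ?F = "F0 \<union> (\<Union>x\<in>X. \<Phi> x)"
  have F: "finite ?F" using assms * by auto
  have FG: "?F \<subseteq> carrier G" using assms(6) * by blast
  have "finite (S \<union> \<epsilon> ` X)" "S \<union> \<epsilon> ` X \<subseteq> carrier A" using assms * Idp_closed by auto
  then obtain e where e: "e \<in> Idp" "\<And>s. s \<in> S \<union> \<epsilon> ` X \<Longrightarrow> e \<otimes>\<^bsub>A\<^esub> s = s"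
    using ex_local_unit by metis
  have "slice G A e ?F \<odot>\<^bsub>N\<^esub> x = x" if x: "x \<in> X" for x
    by (rule fixed_mono[of "\<epsilon> x" "\<Phi> x"]) (use *[OF x] e x F assms in auto)
  then show thesis using that[of e ?F] e F FG by auto
qed

lemma ex_supports: "x \<in> carrier N \<Longrightarrow> \<exists>F. supports G A \<A> N F x"
  using ex_fixed[of x] unfolding supports_def by blast

text \<open>By \<open>slice_slice_one\<close>, both sides are the action of the slice of
  \<open>a e\<close> over \<open>F\<close>.\<close>

lemma slice_smult_superset:
  assumes "supports G A \<A> N F x" "x \<in> carrier N" "a \<in> carrier A" "finite F'" "F \<subseteq> F'"
  shows "slice G A a F' \<odot>\<^bsub>N\<^esub> x = slice G A a F \<odot>\<^bsub>N\<^esub> x"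
proof -
  obtain e where e: "e \<in> Idp" "finite F" "slice G A e F \<odot>\<^bsub>N\<^esub> x = x"
    using assms(1) by (auto simp: supports_def)
  have "F \<inter> F' = F" using assms by blast
  then show ?thesis
    using slice_slice_one[OF assms(3) e(1) assms(4) e(2) assms(2) e(3)]
      slice_slice_one[OF assms(3) e(1) e(2) e(2) assms(2) e(3)] by simp
qed

lemma base_smult_eq:
  assumes F: "supports G A \<A> N F x" and x: "x \<in> carrier N" and a: "a \<in> carrier A"
  shows "base_smult G A \<A> N a x = slice G A a F \<odot>\<^bsub>N\<^esub> x"
proof -
  let ?F = "SOME F. supports G A \<A> N F x"
  have F': "supports G A \<A> N ?F x" using ex_supports[OF x] by (rule someI_ex)
  \<comment> \<open>Two supporting sets are compared through their union.\<close>
  have "finite (F \<union> ?F)" using F F' by (auto simp: supports_def)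
  then show ?thesis unfolding base_smult_def
    using slice_smult_superset[OF F x a, of "F \<union> ?F"] slice_smult_superset[OF F' x a, of "F \<union> ?F"]
    by simp
qed

lemma ex_common_supports:
  assumes "finite X" "X \<subseteq> carrier N"
  obtains F where "\<And>x. x \<in> X \<Longrightarrow> supports G A \<A> N F x"
proof (rule ex_common_fixed[OF assms, of "{}" "{}"])
  show thesis if "e \<in> Idp" "finite F" "F \<subseteq> carrier G" "\<And>x. x \<in> X \<Longrightarrow> slice G A e F \<odot>\<^bsub>N\<^esub> x = x" for e F
    using that \<open>\<And>F. (\<And>x. x \<in> X \<Longrightarrow> supports G A \<A> N F x) \<Longrightarrow> thesis\<close>[of F]
    unfolding supports_def by blast
qed auto

section \<open>The recovered action of the graded ring\<close>

lemma base_smult_closed: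
  assumes "a \<in> carrier A" "x \<in> carrier N" shows "base_smult G A \<A> N a x \<in> carrier N"
proof -
  obtain F where "supports G A \<A> N F x" using ex_supports assms by blast
  then show ?thesis using assms base_smult_eq by (simp add: slice_smult_closed supports_def)
qed

lemma base_smult_l_distr:
  assumes "a \<in> carrier A" "b \<in> carrier A" "x \<in> carrier N"
  shows "base_smult G A \<A> N (a \<oplus>\<^bsub>A\<^esub> b) x = base_smult G A \<A> N a x \<oplus>\<^bsub>N\<^esub> base_smult G A \<A> N b x"
proof -
  obtain F where "supports G A \<A> N F x" using ex_supports assms by blast
  then show ?thesis using assms
    by (simp add: base_smult_eq slice_add smult_l_distr slice_closed supports_def)
qed

lemma base_smult_r_distr:
  assumes "a \<in> carrier A" "x \<in> carrier N" "y \<in> carrier N"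
  shows "base_smult G A \<A> N a (x \<oplus>\<^bsub>N\<^esub> y) = base_smult G A \<A> N a x \<oplus>\<^bsub>N\<^esub> base_smult G A \<A> N a y"
proof -
  obtain F where F: "\<And>z. z \<in> {x, y, x \<oplus>\<^bsub>N\<^esub> y} \<Longrightarrow> supports G A \<A> N F z"
    using ex_common_supports[of "{x, y, x \<oplus>\<^bsub>N\<^esub> y}"] assms by auto
  then have "finite F" by (auto simp: supports_def)
  then show ?thesis
    using assms F by (simp add: base_smult_eq[of F] smult_r_distr slice_closed)
qed

text \<open>The identity \<open>mult\<close> is used for two values of \<open>c\<close>. With
  \<open>a\<close> it gives associativity; with a left unit \<open>e\<close> of \<open>b\<close> it
  shows that \<open>F'\<close> supports \<open>b x\<close>, so that \<open>F'\<close> may be used to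
  compute the outer product.\<close>

lemma base_smult_assoc:
  assumes a: "a \<in> carrier A" and b: "b \<in> carrier A" and x: "x \<in> carrier N"
  shows "base_smult G A \<A> N (a \<otimes>\<^bsub>A\<^esub> b) x = base_smult G A \<A> N a (base_smult G A \<A> N b x)"
proof -
  obtain F where F: "supports G A \<A> N F x" using ex_supports x by blast
  then have fin: "finite F" "F \<subseteq> carrier G" by (auto simp: supports_def)
  obtain F' where F': "finite F'" "F' \<subseteq> carrier G" "\<And>\<alpha> \<beta>. \<alpha> \<in> carrier G \<Longrightarrow> \<beta> \<in> carrier G \<Longrightarrow>
      AC.cmp (slice G A b F \<beta>) (\<alpha> \<otimes>\<^bsub>G\<^esub> inv\<^bsub>G\<^esub> \<beta>) \<noteq> \<zero>\<^bsub>A\<^esub> \<Longrightarrow> \<alpha> \<in> F'"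
    using left_support[OF slice_closed[OF b fin(1)]] by metis
  have sup: "\<alpha> \<in> F'" if "\<alpha> \<in> carrier G" "\<beta> \<in> F" "AC.cmp b (\<alpha> \<otimes>\<^bsub>G\<^esub> inv\<^bsub>G\<^esub> \<beta>) \<noteq> \<zero>\<^bsub>A\<^esub>" for \<alpha> \<beta>
  proof -
    have "\<beta> \<in> carrier G" using that fin by auto
    then show ?thesis using F'(3)[of \<alpha> \<beta>] that by (simp add: slice_apply)
  qed
  have mult: "slice G A c F' \<odot>\<^bsub>N\<^esub> (slice G A b F \<odot>\<^bsub>N\<^esub> x) = slice G A (c \<otimes>\<^bsub>A\<^esub> b) F \<odot>\<^bsub>N\<^esub> x"
    if c: "c \<in> carrier A" for c
  proof -
    have "slice G A c F' \<otimes>\<^bsub>Sm\<^esub> slice G A b F = slice G A (c \<otimes>\<^bsub>A\<^esub> b) F"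
      by (rule slice_mult_slice) (use c b F' fin sup in auto)
    then show ?thesis using smult_assoc[OF slice_closed slice_closed x] c b F' fin by metis
  qed
  obtain e where e: "e \<in> Idp" "e \<otimes>\<^bsub>A\<^esub> b = b"
    using ex_local_unit[of "{b}"] b by (metis finite.simps empty_subsetI insert_subset insertI1)
  have "supports G A \<A> N F' (slice G A b F \<odot>\<^bsub>N\<^esub> x)"
    unfolding supports_def using F' e mult[of e] Idp_closed by auto
  then show ?thesis
    using a b x F fin mult[OF a] by (simp add: base_smult_eq A.m_closed slice_smult_closed)
qed

section \<open>The recovered grading\<close>

lemma base_part_carrier: "base_part G A \<A> N \<gamma> \<subseteq> carrier N"
  by (auto simp: base_part_def)

lemma base_partI:
  "\<lbrakk>x \<in> carrier N; \<gamma> \<in> carrier G; e \<in> Idp; slice G A e {\<gamma>} \<odot>\<^bsub>N\<^esub> x = x\<rbrakk> \<Longrightarrow> x \<in> base_part G A \<A> N \<gamma>"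
  by (auto simp: base_part_def supports_def)

lemma ex_base_part_unit:
  assumes "x \<in> base_part G A \<A> N \<gamma>"
  obtains e where "e \<in> Idp" "slice G A e {\<gamma>} \<odot>\<^bsub>N\<^esub> x = x"
  using assms by (auto simp: base_part_def supports_def)

lemma base_part_subgroup:
  assumes \<gamma>: "\<gamma> \<in> carrier G" shows "subgroup (base_part G A \<A> N \<gamma>) (add_monoid N)"
proof
  show "base_part G A \<A> N \<gamma> \<subseteq> carrier (add_monoid N)" using base_part_carrier by simp
next
  fix x y assume x: "x \<in> base_part G A \<A> N \<gamma>" and y: "y \<in> base_part G A \<A> N \<gamma>"
  have xN: "x \<in> carrier N" and yN: "y \<in> carrier N" using x y base_part_carrier by auto
  obtain e1 where e1: "e1 \<in> Idp" "slice G A e1 {\<gamma>} \<odot>\<^bsub>N\<^esub> x = x" by (rule ex_base_part_unit[OF x])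
  obtain e2 where e2: "e2 \<in> Idp" "slice G A e2 {\<gamma>} \<odot>\<^bsub>N\<^esub> y = y" by (rule ex_base_part_unit[OF y])
  obtain e where e: "e \<in> Idp" "\<And>s. s \<in> {e1, e2} \<Longrightarrow> e \<otimes>\<^bsub>A\<^esub> s = s"
    using ex_local_unit[of "{e1, e2}"] e1 e2 Idp_closed by (metis finite.simps empty_subsetI insert_subset)
  have "slice G A e {\<gamma>} \<odot>\<^bsub>N\<^esub> x = x" "slice G A e {\<gamma>} \<odot>\<^bsub>N\<^esub> y = y"
    using e e1 e2 xN yN fixed_mono[of e1 "{\<gamma>}" x e "{\<gamma>}"] fixed_mono[of e2 "{\<gamma>}" y e "{\<gamma>}"] by auto
  then have "slice G A e {\<gamma>} \<odot>\<^bsub>N\<^esub> (x \<oplus>\<^bsub>N\<^esub> y) = x \<oplus>\<^bsub>N\<^esub> y"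
    using xN yN e Idp_closed by (simp add: smult_r_distr slice_closed)
  then show "x \<otimes>\<^bsub>add_monoid N\<^esub> y \<in> base_part G A \<A> N \<gamma>"
    using base_partI[OF _ \<gamma> e(1)] xN yN by simp
next
  obtain e where e: "e \<in> Idp" using ex_local_unit[of "{}"] by auto
  then have "slice G A e {\<gamma>} \<odot>\<^bsub>N\<^esub> \<zero>\<^bsub>N\<^esub> = \<zero>\<^bsub>N\<^esub>" by (simp add: smult_r_null slice_closed Idp_closed)
  then show "\<one>\<^bsub>add_monoid N\<^esub> \<in> base_part G A \<A> N \<gamma>" using base_partI[OF _ \<gamma> e] by simp
next
  fix x assume x: "x \<in> base_part G A \<A> N \<gamma>"
  have xN: "x \<in> carrier N" using x base_part_carrier by auto
  obtain e where e: "e \<in> Idp" "slice G A e {\<gamma>} \<odot>\<^bsub>N\<^esub> x = x" by (rule ex_base_part_unit[OF x])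
  have "slice G A e {\<gamma>} \<odot>\<^bsub>N\<^esub> (\<ominus>\<^bsub>N\<^esub> x) = \<ominus>\<^bsub>N\<^esub> x"
    using e xN by (simp add: smult_minus slice_closed Idp_closed)
  then have "\<ominus>\<^bsub>N\<^esub> x \<in> base_part G A \<A> N \<gamma>" using base_partI[OF _ \<gamma> e(1)] xN by simp
  then show "inv\<^bsub>add_monoid N\<^esub> x \<in> base_part G A \<A> N \<gamma>" by (simp add: a_inv_def)
qed

text \<open>\<open>F\<close> meets {\<beta>} in {\<beta>} or not at all, and
  \<open>e' e = e\<close>. So the projection of \<open>x\<close> to degree \<beta> does not change
  when \<open>e\<close> is replaced by an idempotent that dominates it.\<close>

lemma slice_smult_projection:
  assumes e: "e \<in> Idp" and F: "finite F" "F \<subseteq> carrier G" and x: "x \<in> carrier N"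
    and fix_x: "slice G A e F \<odot>\<^bsub>N\<^esub> x = x" and e': "e' \<in> Idp" "e' \<otimes>\<^bsub>A\<^esub> e = e"
  shows "slice G A e' {\<beta>} \<odot>\<^bsub>N\<^esub> x = (if \<beta> \<in> F then slice G A e {\<beta>} \<odot>\<^bsub>N\<^esub> x else \<zero>\<^bsub>N\<^esub>)"
  using slice_slice_one[OF Idp_closed[OF e'(1)] e _ F(1) x fix_x, of "{\<beta>}"] x e'(2)
  by (cases "\<beta> \<in> F") (simp_all add: slice_empty smult_l_null)

text \<open>Splitting \<open>e p_F\<close> into monomials splits \<open>x = e p_F x\<close> into the
  summands \<open>e p_\<gamma> x\<close>. Each is fixed by \<open>e p_\<gamma>\<close>, which is
  idempotent because \<open>e\<close> is an idempotent of degree \<epsilon>.\<close>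

lemma decomposition_base_part:
  assumes e: "e \<in> Idp" and F: "finite F" "F \<subseteq> carrier G" and x: "x \<in> carrier N"
    and fix_x: "slice G A e F \<odot>\<^bsub>N\<^esub> x = x"
  shows "decomposition N (carrier G) (base_part G A \<A> N) x
    (\<lambda>\<gamma>\<in>carrier G. slice G A e {\<gamma>} \<odot>\<^bsub>N\<^esub> x)" (is "decomposition _ _ _ _ ?c")
proof -
  have eA: "e \<in> carrier A" using e Idp_closed by blast
  have cl: "slice G A e {\<gamma>} \<odot>\<^bsub>N\<^esub> x \<in> carrier N" for \<gamma> using eA x by (simp add: slice_smult_closed)
  have zero: "slice G A e {\<gamma>} \<odot>\<^bsub>N\<^esub> x = \<zero>\<^bsub>N\<^esub>" if "\<gamma> \<notin> F" for \<gamma>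
    using slice_smult_projection[OF e F x fix_x e Idp_idem[OF e], of \<gamma>] that by simp
  have "slice G A e {\<gamma>} \<odot>\<^bsub>N\<^esub> x \<in> base_part G A \<A> N \<gamma>" if \<gamma>: "\<gamma> \<in> carrier G" for \<gamma>
  proof (rule base_partI[OF cl \<gamma> e])
    have "slice G A e {\<gamma>} \<otimes>\<^bsub>Sm\<^esub> slice G A e {\<gamma>} = slice G A e {\<gamma>}"
      using eA e by (simp add: slice_mult_slice_one Idp_part Idp_idem)
    then show "slice G A e {\<gamma>} \<odot>\<^bsub>N\<^esub> (slice G A e {\<gamma>} \<odot>\<^bsub>N\<^esub> x) = slice G A e {\<gamma>} \<odot>\<^bsub>N\<^esub> x"
      using smult_assoc[of "slice G A e {\<gamma>}" "slice G A e {\<gamma>}" x] eA x by (simp add: slice_closed)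
  qed
  then have PiE: "?c \<in> (\<Pi>\<^sub>E \<gamma>\<in>carrier G. base_part G A \<A> N \<gamma>)" by auto
  have sub: "{\<gamma> \<in> carrier G. ?c \<gamma> \<noteq> \<zero>\<^bsub>N\<^esub>} \<subseteq> F" using zero by auto
  then have fin: "finite {\<gamma> \<in> carrier G. ?c \<gamma> \<noteq> \<zero>\<^bsub>N\<^esub>}" using F finite_subset by blast
  have "x = (\<Oplus>\<^bsub>Sm\<^esub>\<gamma>\<in>F. slice G A (slice G A e F \<gamma>) {\<gamma>}) \<odot>\<^bsub>N\<^esub> x"
    using sum_slices[OF slice_closed[OF eA F(1)] F] fix_x by (simp add: slice_apply)
  also have "\<dots> = (\<Oplus>\<^bsub>N\<^esub>\<gamma>\<in>F. slice G A (slice G A e F \<gamma>) {\<gamma>} \<odot>\<^bsub>N\<^esub> x)"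
    by (rule smult_finsum_left[OF x]) (use F eA in \<open>auto intro!: slice_closed simp: slice_apply\<close>)
  also have "\<dots> = (\<Oplus>\<^bsub>N\<^esub>\<gamma>\<in>F. ?c \<gamma>)"
    by (rule M.finsum_cong') (use F cl in \<open>auto simp: slice_apply\<close>)
  also have "\<dots> = (\<Oplus>\<^bsub>N\<^esub>\<gamma>\<in>{\<gamma> \<in> carrier G. ?c \<gamma> \<noteq> \<zero>\<^bsub>N\<^esub>}. ?c \<gamma>)"
    by (rule M.add.finprod_mono_neutral_cong_right) (use F sub cl in auto)
  finally show ?thesis using PiE fin unfolding decomposition_def by blast
qed

text \<open>Apply \<open>u p_\<beta>\<close>, where \<open>u\<close> is a left unit for
  \<open>e\<close> and for the idempotents that fix the given components: this removes every
  \<open>c \<gamma>\<close> except \<open>c \<beta>\<close>, while on \<open>x\<close> it has the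
  same effect as \<open>e p_\<beta>\<close>.\<close>

lemma decomposition_base_part_unique:
  assumes e: "e \<in> Idp" and F: "finite F" "F \<subseteq> carrier G" and x: "x \<in> carrier N"
    and fix_x: "slice G A e F \<odot>\<^bsub>N\<^esub> x = x"
    and c: "decomposition N (carrier G) (base_part G A \<A> N) x c" and \<beta>: "\<beta> \<in> carrier G"
  shows "c \<beta> = slice G A e {\<beta>} \<odot>\<^bsub>N\<^esub> x"
proof -
  let ?S = "{\<gamma> \<in> carrier G. c \<gamma> \<noteq> \<zero>\<^bsub>N\<^esub>}"
  have S: "finite ?S" "x = (\<Oplus>\<^bsub>N\<^esub>\<gamma>\<in>?S. c \<gamma>)" and cpart: "\<And>\<gamma>. \<gamma> \<in> carrier G \<Longrightarrow> c \<gamma> \<in> base_part G A \<A> N \<gamma>"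
    using c by (auto simp: decomposition_def)
  have "\<forall>\<gamma>\<in>carrier G. \<exists>d. d \<in> Idp \<and> slice G A d {\<gamma>} \<odot>\<^bsub>N\<^esub> c \<gamma> = c \<gamma>"
    using cpart ex_base_part_unit by metis
  then obtain d where d: "\<And>\<gamma>. \<gamma> \<in> carrier G \<Longrightarrow> d \<gamma> \<in> Idp \<and> slice G A (d \<gamma>) {\<gamma>} \<odot>\<^bsub>N\<^esub> c \<gamma> = c \<gamma>"
    by metis
  have cN: "c \<gamma> \<in> carrier N" if "\<gamma> \<in> carrier G" for \<gamma> using cpart[OF that] base_part_carrier by auto
  have "finite (insert e (d ` ?S))" "insert e (d ` ?S) \<subseteq> carrier A"
    using S(1) d e Idp_closed by auto
  then obtain u where u: "u \<in> Idp" "\<And>s. s \<in> insert e (d ` ?S) \<Longrightarrow> u \<otimes>\<^bsub>A\<^esub> s = s"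
    using ex_local_unit by metis
  have uA: "u \<in> carrier A" using u Idp_closed by blast
  have ucl: "slice G A u {\<beta>} \<in> carrier Sm" by (simp add: slice_closed uA)
  have ue: "u \<otimes>\<^bsub>A\<^esub> e = e" using u(2) by auto
  have uc: "slice G A u {\<beta>} \<odot>\<^bsub>N\<^esub> c \<gamma> = (if \<beta> = \<gamma> then c \<gamma> else \<zero>\<^bsub>N\<^esub>)" if \<gamma>: "\<gamma> \<in> ?S" for \<gamma>
  proof -
    have "slice G A u {\<beta>} \<odot>\<^bsub>N\<^esub> c \<gamma> = (if \<beta> \<in> {\<gamma>} then slice G A (d \<gamma>) {\<beta>} \<odot>\<^bsub>N\<^esub> c \<gamma> else \<zero>\<^bsub>N\<^esub>)"
      by (rule slice_smult_projection) (use \<gamma> d[of \<gamma>] cN u in auto)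
    then show ?thesis using d[of \<gamma>] \<gamma> by auto
  qed
  have proj: "slice G A u {\<beta>} \<odot>\<^bsub>N\<^esub> x = slice G A e {\<beta>} \<odot>\<^bsub>N\<^esub> x"
    using slice_smult_projection[OF e F x fix_x u(1) ue, of \<beta>]
      slice_smult_projection[OF e F x fix_x e Idp_idem[OF e], of \<beta>] by simp
  have "slice G A u {\<beta>} \<odot>\<^bsub>N\<^esub> (\<Oplus>\<^bsub>N\<^esub>\<gamma>\<in>?S. c \<gamma>) = (\<Oplus>\<^bsub>N\<^esub>\<gamma>\<in>?S. slice G A u {\<beta>} \<odot>\<^bsub>N\<^esub> c \<gamma>)"
    by (rule smult_finsum_right[OF ucl]) (use cN in auto)
  also have "\<dots> = (\<Oplus>\<^bsub>N\<^esub>\<gamma>\<in>?S. if \<beta> = \<gamma> then c \<gamma> else \<zero>\<^bsub>N\<^esub>)"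
    by (rule M.finsum_cong') (use cN uc in auto)
  also have "\<dots> = c \<beta>"
  proof (cases "\<beta> \<in> ?S")
    case True
    then show ?thesis using S(1) cN by (intro M.finsum_singleton) auto
  next
    case False
    then have "(\<Oplus>\<^bsub>N\<^esub>\<gamma>\<in>?S. if \<beta> = \<gamma> then c \<gamma> else \<zero>\<^bsub>N\<^esub>) = (\<Oplus>\<^bsub>N\<^esub>\<gamma>\<in>?S. \<zero>\<^bsub>N\<^esub>)"
      by (intro M.finsum_cong') auto
    then show ?thesis using False \<beta> by (simp add: M.finsum_zero)
  qed
  finally show ?thesis using proj S(2) by (simp only:)
qed

lemma base_part_direct_sum: "internal_direct_sum N (carrier G) (base_part G A \<A> N)"
  unfolding internal_direct_sum_def
proof (intro conjI ballI base_part_subgroup)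
  fix x assume x: "x \<in> carrier N"
  obtain e F where e: "e \<in> Idp" "finite F" "F \<subseteq> carrier G" "slice G A e F \<odot>\<^bsub>N\<^esub> x = x"
    using ex_fixed[OF x] by blast
  note dec = decomposition_base_part[OF e(1-3) x e(4)]
  show "\<exists>!c. decomposition N (carrier G) (base_part G A \<A> N) x c"
  proof (rule ex1I, rule dec)
    fix c assume c: "decomposition N (carrier G) (base_part G A \<A> N) x c"
    then have "c \<in> extensional (carrier G)" by (auto simp: decomposition_def PiE_def)
    then show "c = (\<lambda>\<gamma>\<in>carrier G. slice G A e {\<gamma>} \<odot>\<^bsub>N\<^esub> x)"
      using decomposition_base_part_unique[OF e(1-3) x e(4) c] by (intro extensionalityI) auto
  qed
qed

lemma component_base_part:
  assumes "e \<in> Idp" "finite F" "F \<subseteq> carrier G" "x \<in> carrier N" "slice G A e F \<odot>\<^bsub>N\<^esub> x = x"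
    and "\<gamma> \<in> carrier G"
  shows "component G N (base_part G A \<A> N) x \<gamma> = slice G A e {\<gamma>} \<odot>\<^bsub>N\<^esub> x"
proof -
  interpret D: graded_group G N "base_part G A \<A> N"
    by unfold_locales (rule base_part_direct_sum)
  show ?thesis using D.component_eq[OF assms(4) decomposition_base_part[OF assms(1-5)]] assms(6) by simp
qed

text \<open>For \<open>a\<close> of degree \<alpha>, the product of \<open>e p_\<mu>\<close> and
  \<open>a p_\<gamma>\<close> vanishes unless \<mu> = \<alpha>\<gamma>, and for that index a left
  unit \<open>e\<close> of \<open>a\<close> gives back \<open>a p_\<gamma>\<close>. So the result is
  fixed by a monomial at \<alpha>\<gamma>.\<close>

lemma base_smult_part:
  assumes \<alpha>: "\<alpha> \<in> carrier G" and \<gamma>: "\<gamma> \<in> carrier G" and a: "a \<in> \<A> \<alpha>"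
    and x: "x \<in> base_part G A \<A> N \<gamma>"
  shows "base_smult G A \<A> N a x \<in> base_part G A \<A> N (\<alpha> \<otimes>\<^bsub>G\<^esub> \<gamma>)"
proof -
  have xN: "x \<in> carrier N" and sup: "supports G A \<A> N {\<gamma>} x" using x by (auto simp: base_part_def)
  have aA: "a \<in> carrier A" using a \<alpha> AC.part_carrier by blast
  obtain e where e: "e \<in> Idp" "e \<otimes>\<^bsub>A\<^esub> a = a"
    using ex_local_unit[of "{a}"] aA by (metis finite.simps empty_subsetI insert_subset insertI1)
  have eA: "e \<in> carrier A" using e Idp_closed by blast
  have deg: "\<beta> = \<alpha> \<otimes>\<^bsub>G\<^esub> \<gamma>" if "\<beta> \<in> carrier G" "\<beta> \<otimes>\<^bsub>G\<^esub> inv\<^bsub>G\<^esub> \<gamma> = \<alpha>" for \<beta>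
    using that \<alpha> \<gamma> by (metis G.inv_solve_right')
  have "slice G A e {\<alpha> \<otimes>\<^bsub>G\<^esub> \<gamma>} \<otimes>\<^bsub>Sm\<^esub> slice G A a {\<gamma>} = slice G A (e \<otimes>\<^bsub>A\<^esub> a) {\<gamma>}"
    by (rule slice_mult_slice) (use eA aA a \<alpha> \<gamma> deg in
        \<open>auto simp: AC.component_homogeneous split: if_splits\<close>)
  then have "slice G A e {\<alpha> \<otimes>\<^bsub>G\<^esub> \<gamma>} \<odot>\<^bsub>N\<^esub> (slice G A a {\<gamma>} \<odot>\<^bsub>N\<^esub> x) = slice G A a {\<gamma>} \<odot>\<^bsub>N\<^esub> x"
    using smult_assoc[of "slice G A e {\<alpha> \<otimes>\<^bsub>G\<^esub> \<gamma>}" "slice G A a {\<gamma>}" x] eA aA xN e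
    by (simp add: slice_closed)
  then show ?thesis
    unfolding base_smult_eq[OF sup xN aA]
    using e aA xN \<alpha> \<gamma> by (intro base_partI[of _ _ e]) (auto simp: slice_smult_closed)
qed

lemma ex_base_unit:
  assumes "x \<in> carrier N" shows "\<exists>e\<in>carrier A. base_smult G A \<A> N e x = x"
proof -
  obtain e F where e: "e \<in> Idp" "finite F" "F \<subseteq> carrier G" "slice G A e F \<odot>\<^bsub>N\<^esub> x = x"
    using ex_fixed[OF assms] by blast
  then have "supports G A \<A> N F x" by (auto simp: supports_def)
  then show ?thesis using e assms base_smult_eq Idp_closed by metis
qed

text \<open>Taken monomial by monomial, this says that \<open>f \<gamma> p_\<gamma>\<close> sees
  only the component of \<open>x\<close> in degree \<gamma>. It is the computation behind
  \<open>smash_of_graded_of_smash\<close>.\<close>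

lemma smash_act_base:
  assumes f: "f \<in> carrier Sm" and x: "x \<in> carrier N"
  shows "(\<Oplus>\<^bsub>N\<^esub>\<gamma>\<in>{\<gamma> \<in> carrier G. f \<gamma> \<noteq> \<zero>\<^bsub>A\<^esub>}.
    base_smult G A \<A> N (f \<gamma>) (component G N (base_part G A \<A> N) x \<gamma>)) = f \<odot>\<^bsub>N\<^esub> x"
proof -
  let ?S = "{\<gamma> \<in> carrier G. f \<gamma> \<noteq> \<zero>\<^bsub>A\<^esub>}"
  interpret D: graded_group G N "base_part G A \<A> N"
    by unfold_locales (rule base_part_direct_sum)
  \<comment> \<open>\<open>F\<close> is made to contain the support of \<open>f\<close>, so that it
    contains each {\<gamma>} used below.\<close>
  obtain e F where e: "e \<in> Idp" "finite F" "F \<subseteq> carrier G" "?S \<subseteq> F" "slice G A e F \<odot>\<^bsub>N\<^esub> x = x"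
    and ef: "\<And>s. s \<in> {} \<Longrightarrow> e \<otimes>\<^bsub>A\<^esub> s = s"
    using ex_common_fixed[of "{x}" "{}" ?S] x smash_finite[OF f] by auto
  have eA: "e \<in> carrier A" using e Idp_closed by blast
  have eq: "base_smult G A \<A> N (f \<gamma>) (D.cmp x \<gamma>) = slice G A (f \<gamma>) {\<gamma>} \<odot>\<^bsub>N\<^esub> x" if \<gamma>: "\<gamma> \<in> ?S" for \<gamma>
  proof -
    have f\<gamma>: "f \<gamma> \<in> carrier A" using smash_value[OF f] \<gamma> by auto
    have "D.cmp x \<gamma> \<in> base_part G A \<A> N \<gamma>" using D.component_part x \<gamma> by auto
    then have "base_smult G A \<A> N (f \<gamma>) (D.cmp x \<gamma>) = slice G A (f \<gamma>) {\<gamma>} \<odot>\<^bsub>N\<^esub> D.cmp x \<gamma>"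
      using f\<gamma> by (intro base_smult_eq) (auto simp: base_part_def)
    also have "\<dots> = slice G A (f \<gamma>) {\<gamma>} \<odot>\<^bsub>N\<^esub> (slice G A e {\<gamma>} \<odot>\<^bsub>N\<^esub> x)"
      using component_base_part[OF e(1-3) x e(5)] \<gamma> by simp
    also have "\<dots> = (slice G A (f \<gamma>) {\<gamma>} \<otimes>\<^bsub>Sm\<^esub> slice G A e {\<gamma>}) \<odot>\<^bsub>N\<^esub> x"
      using f\<gamma> eA x by (simp add: smult_assoc slice_closed)
    also have "\<dots> = slice G A (f \<gamma> \<otimes>\<^bsub>A\<^esub> e) {\<gamma>} \<odot>\<^bsub>N\<^esub> x"
      using f\<gamma> e by (simp add: slice_mult_slice_one Idp_part)
    \<comment> \<open>\<open>e\<close> need not be a right unit of \<open>f \<gamma>\<close>; the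
      factor is absorbed because the slice of \<open>e\<close> over \<open>F\<close> fixes
      \<open>x\<close>.\<close>
    also have "\<dots> = slice G A (f \<gamma>) {\<gamma>} \<odot>\<^bsub>N\<^esub> x"
    proof -
      have "F \<inter> {\<gamma>} = {\<gamma>}" using e(4) \<gamma> by auto
      then show ?thesis using slice_slice_one[OF f\<gamma> e(1) _ e(2) x e(5), of "{\<gamma>}"] by simp
    qed
    finally show ?thesis .
  qed
  have cl: "(\<lambda>\<gamma>. slice G A (f \<gamma>) {\<gamma>}) \<in> ?S \<rightarrow> carrier Sm"
    using smash_value[OF f] by (auto intro!: slice_closed)
  have "(\<Oplus>\<^bsub>N\<^esub>\<gamma>\<in>?S. base_smult G A \<A> N (f \<gamma>) (D.cmp x \<gamma>))
      = (\<Oplus>\<^bsub>N\<^esub>\<gamma>\<in>?S. slice G A (f \<gamma>) {\<gamma>} \<odot>\<^bsub>N\<^esub> x)"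
    by (rule M.finsum_cong') (use eq cl x smult_closed in auto)
  also have "\<dots> = (\<Oplus>\<^bsub>Sm\<^esub>\<gamma>\<in>?S. slice G A (f \<gamma>) {\<gamma>}) \<odot>\<^bsub>N\<^esub> x"
    by (rule smult_finsum_left[OF x cl, symmetric])
  also have "(\<Oplus>\<^bsub>Sm\<^esub>\<gamma>\<in>?S. slice G A (f \<gamma>) {\<gamma>}) = f"
    by (rule sum_slices[OF f smash_finite[OF f]]) auto
  finally show ?thesis .
qed

end

section \<open>The isomorphism of categories\<close>

text \<open>Off the carriers the scalar multiplication is \<open>undefined\<close>, as
  \<open>normalized_module\<close> demands; this is what lets the round trips end in the very same
  record. \<open>graded_of_smash\<close> follows the same rule.\<close>

definition smash_of_graded ::
  "('g, 'x) monoid_scheme \<Rightarrow> ('a, 'y) ring_scheme \<Rightarrow> ('g \<Rightarrow> 'a set) \<Rightarrow> ('a, 'm, 'g) graded_module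
    \<Rightarrow> ('g \<Rightarrow> 'a, 'm) module" where
  "smash_of_graded G A \<A> M =
     \<lparr>carrier = carrier M, mult = undefined, one = undefined, zero = zero M, add = add M,
      smult = (\<lambda>f x. if f \<in> carrier (smash_product G A \<A>) \<and> x \<in> carrier M
        then smash_act G A M (part M) f x else undefined)\<rparr>"

definition graded_of_smash ::
  "('g, 'x) monoid_scheme \<Rightarrow> ('a, 'y) ring_scheme \<Rightarrow> ('g \<Rightarrow> 'a set) \<Rightarrow> ('g \<Rightarrow> 'a, 'm) module
    \<Rightarrow> ('a, 'm, 'g) graded_module" where
  "graded_of_smash G A \<A> N =
     \<lparr>carrier = carrier N, mult = undefined, one = undefined, zero = zero N, add = add N,
      smult = (\<lambda>a x. if a \<in> carrier A \<and> x \<in> carrier N then base_smult G A \<A> N a x else undefined),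
      part = (\<lambda>\<gamma>\<in>carrier G. base_part G A \<A> N \<gamma>)\<rparr>"

lemma smash_of_graded_simps [simp]:
  "carrier (smash_of_graded G A \<A> M) = carrier M"
  "add (smash_of_graded G A \<A> M) = add M"
  "zero (smash_of_graded G A \<A> M) = zero M"
  "\<lbrakk>f \<in> carrier (smash_product G A \<A>); x \<in> carrier M\<rbrakk>
    \<Longrightarrow> f \<odot>\<^bsub>smash_of_graded G A \<A> M\<^esub> x = smash_act G A M (part M) f x"
  by (simp_all add: smash_of_graded_def)

lemma graded_of_smash_simps [simp]:
  "carrier (graded_of_smash G A \<A> N) = carrier N"
  "add (graded_of_smash G A \<A> N) = add N"
  "zero (graded_of_smash G A \<A> N) = zero N"
  "part (graded_of_smash G A \<A> N) = (\<lambda>\<gamma>\<in>carrier G. base_part G A \<A> N \<gamma>)"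
  "\<lbrakk>a \<in> carrier A; x \<in> carrier N\<rbrakk>
    \<Longrightarrow> a \<odot>\<^bsub>graded_of_smash G A \<A> N\<^esub> x = base_smult G A \<A> N a x"
  by (simp_all add: graded_of_smash_def)

lemma decomposition_cong:
  assumes "\<And>i. i \<in> I \<Longrightarrow> F i = F' i" shows "decomposition H I F = decomposition H I F'"
proof -
  have "(\<Pi>\<^sub>E i\<in>I. F i) = (\<Pi>\<^sub>E i\<in>I. F' i)" using assms by (rule PiE_cong)
  then show ?thesis by (intro ext) (simp add: decomposition_def)
qed

lemma internal_direct_sum_cong:
  assumes "\<And>i. i \<in> I \<Longrightarrow> F i = F' i" shows "internal_direct_sum H I F \<longleftrightarrow> internal_direct_sum H I F'"
  using assms by (simp add: internal_direct_sum_def decomposition_cong[OF assms])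

lemma component_cong:
  assumes "\<And>\<gamma>. \<gamma> \<in> carrier G \<Longrightarrow> P \<gamma> = P' \<gamma>" shows "component G M P = component G M P'"
  by (intro ext) (simp add: component_def decomposition_cong[OF assms])

section \<open>The two module categories\<close>

lemma category_module_category: "category (module_category B)"
proof unfold_locales
  fix L assume "L \<in> Obj (module_category B)"
  then interpret unital_module B L by (simp add: module_category_def)
  show "Ident (module_category B) L \<in> Hom (module_category B) L L"
    by (auto simp: module_category_def linear_maps_def smult_closed)
next
  fix L M N f g
  assume "L \<in> Obj (module_category B)" "f \<in> Hom (module_category B) L M" "g \<in> Hom (module_category B) M N"
  then interpret unital_module B L by (simp add: module_category_def)
  have f: "f \<in> linear_maps B L M" and g: "g \<in> linear_maps B M N"
    using \<open>f \<in> Hom _ _ _\<close> \<open>g \<in> Hom _ _ _\<close> by (simp_all add: module_category_def)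
  then have fM: "f x \<in> carrier M" if "x \<in> carrier L" for x using that by (auto simp: linear_maps_def)
  then show "Comp (module_category B) L M N g f \<in> Hom (module_category B) L N"
    using f g by (auto simp: module_category_def linear_maps_def compose_def smult_closed)
qed (auto simp: module_category_def linear_maps_def compose_def fun_eq_iff PiE_def extensional_def Pi_def)

lemma category_graded_module_category: "category (graded_module_category G A \<A>)"
proof unfold_locales
  fix L assume L: "L \<in> Obj (graded_module_category G A \<A>)"
  then interpret unital_module A L by (simp add: graded_module_category_def is_graded_module_def)
  interpret graded_group G L "part L"
    using L by unfold_locales (simp add: graded_module_category_def is_graded_module_def)
  show "Ident (graded_module_category G A \<A>) L \<in> Hom (graded_module_category G A \<A>) L L"
    by (auto simp: graded_module_category_def linear_maps_def smult_closed part_carrier)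
next
  fix L M N f g
  assume L: "L \<in> Obj (graded_module_category G A \<A>)"
    and f: "f \<in> Hom (graded_module_category G A \<A>) L M"
    and g: "g \<in> Hom (graded_module_category G A \<A>) M N"
  interpret unital_module A L using L by (simp add: graded_module_category_def is_graded_module_def)
  interpret graded_group G L "part L"
    using L by unfold_locales (simp add: graded_module_category_def is_graded_module_def)
  have f': "f \<in> linear_maps A L M" "\<And>\<gamma>. \<gamma> \<in> carrier G \<Longrightarrow> f ` part L \<gamma> \<subseteq> part M \<gamma>"
    and g': "g \<in> linear_maps A M N" "\<And>\<gamma>. \<gamma> \<in> carrier G \<Longrightarrow> g ` part M \<gamma> \<subseteq> part N \<gamma>"
    using f g by (simp_all add: graded_module_category_def)
  then have fM: "f x \<in> carrier M" if "x \<in> carrier L" for x using that by (auto simp: linear_maps_def)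
  then have "compose (carrier L) g f \<in> linear_maps A L N"
    using f' g' by (auto simp: linear_maps_def compose_def smult_closed)
  moreover have "compose (carrier L) g f ` part L \<gamma> \<subseteq> part N \<gamma>" if \<gamma>: "\<gamma> \<in> carrier G" for \<gamma>
  proof
    fix y assume "y \<in> compose (carrier L) g f ` part L \<gamma>"
    then obtain x where x: "x \<in> part L \<gamma>" "y = compose (carrier L) g f x" by blast
    then have "y = g (f x)" using part_carrier[OF \<gamma>] by (simp add: compose_def)
    then show "y \<in> part N \<gamma>" using f'(2)[OF \<gamma>] g'(2)[OF \<gamma>] x(1) by blast
  qed
  ultimately show "Comp (graded_module_category G A \<A>) L M N g f \<in> Hom (graded_module_category G A \<A>) L N"
    by (simp add: graded_module_category_def)
qed (auto simp: graded_module_category_def linear_maps_def compose_def fun_eq_iff PiE_def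
      extensional_def Pi_def)

context locally_unital_graded_ring
begin

abbreviation "Gr \<equiv> graded_module_category G A \<A>"
abbreviation "SMod \<equiv> module_category Sm"

lemma is_graded_moduleD:
  assumes "is_graded_module G A \<A> M"
  shows "graded_left_module G A \<A> M (part M)" and "unital_module A M"
proof -
  show "unital_module A M" using assms by (simp add: is_graded_module_def)
  then interpret unital_module A M .
  show "graded_left_module G A \<A> M (part M)"
    using assms by unfold_locales (simp_all add: is_graded_module_def)
qed

text \<open>The counterpart of \<open>ex_fixed\<close> on the graded side, by the same domination of
  idempotents.\<close>

lemma ex_graded_unit:
  assumes "is_graded_module G A \<A> M" "x \<in> carrier M"
  shows "\<exists>e\<in>Idp. e \<odot>\<^bsub>M\<^esub> x = x"
proof -
  interpret unital_module A M by (rule is_graded_moduleD(2)[OF assms(1)])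
  show ?thesis using assms(2)
  proof (induction x rule: unital_induct)
    case (smult b x)
    obtain e where e: "e \<in> Idp" "e \<otimes>\<^bsub>A\<^esub> b = b"
      using ex_local_unit[of "{b}"] smult(1) by (metis finite.simps empty_subsetI insert_subset insertI1)
    then have "e \<odot>\<^bsub>M\<^esub> (b \<odot>\<^bsub>M\<^esub> x) = b \<odot>\<^bsub>M\<^esub> x" using smult Idp_closed by (metis smult_assoc)
    then show ?case using e by blast
  next
    case (add x y)
    obtain e1 e2 where e12: "e1 \<in> Idp" "e1 \<odot>\<^bsub>M\<^esub> x = x" "e2 \<in> Idp" "e2 \<odot>\<^bsub>M\<^esub> y = y"
      using add by blast
    obtain e where e: "e \<in> Idp" "\<And>s. s \<in> {e1, e2} \<Longrightarrow> e \<otimes>\<^bsub>A\<^esub> s = s"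
      using ex_local_unit[of "{e1, e2}"] e12 Idp_closed by (metis finite.simps empty_subsetI insert_subset)
    have "e \<odot>\<^bsub>M\<^esub> x = x" "e \<odot>\<^bsub>M\<^esub> y = y"
      using smult_assoc[of e e1 x] smult_assoc[of e e2 y] e e12 add Idp_closed by auto
    then have "e \<odot>\<^bsub>M\<^esub> (x \<oplus>\<^bsub>M\<^esub> y) = x \<oplus>\<^bsub>M\<^esub> y"
      using e(1) add Idp_closed by (simp add: smult_r_distr)
    then show ?case using e(1) by blast
  qed
qed

lemma smash_of_graded_slice:
  assumes M: "is_graded_module G A \<A> M" and a: "a \<in> carrier A" and x: "x \<in> carrier M"
    and F: "finite F" "F \<subseteq> carrier G"
    and sup: "\<And>\<gamma>. \<gamma> \<in> carrier G \<Longrightarrow> component G M (part M) x \<gamma> \<noteq> \<zero>\<^bsub>M\<^esub> \<Longrightarrow> \<gamma> \<in> F"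
  shows "slice G A a F \<odot>\<^bsub>smash_of_graded G A \<A> M\<^esub> x = a \<odot>\<^bsub>M\<^esub> x"
proof -
  interpret graded_left_module G A \<A> M "part M" by (rule is_graded_moduleD(1)[OF M])
  show ?thesis using act_slice_superset[OF a x F sup] a x F by (simp add: slice_closed)
qed

lemma smash_of_graded_unital:
  assumes M: "is_graded_module G A \<A> M"
  shows "unital_module Sm (smash_of_graded G A \<A> M)"
proof -
  let ?N = "smash_of_graded G A \<A> M"
  interpret graded_left_module G A \<A> M "part M" by (rule is_graded_moduleD(1)[OF M])
  interpret S: nonunital_ring Sm by (rule smash_nonunital_ring)
  have ab: "abelian_group ?N" using abelian_group_same[of ?N M] M.abelian_group_axioms by simp
  interpret N: left_module Sm ?N
    by (intro left_module.intro smash_nonunital_ring ab left_module_axioms.intro)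
      (auto simp: act_closed act_add_left act_add_right act_mult smash_add_closed smash_mult_closed)
  show ?thesis
  proof (rule N.unital_moduleI)
    fix x assume "x \<in> carrier ?N"
    then have x: "x \<in> carrier M" by simp
    \<comment> \<open>With \<open>e\<close> fixing \<open>x\<close> and \<open>?F\<close> covering
      its degrees, the slice of \<open>e\<close> over \<open>?F\<close> is a unit for
      \<open>x\<close>.\<close>
    let ?F = "{\<gamma> \<in> carrier G. MC.cmp x \<gamma> \<noteq> \<zero>\<^bsub>M\<^esub>}"
    obtain e where e: "e \<in> Idp" "e \<odot>\<^bsub>M\<^esub> x = x" using ex_graded_unit[OF M x] by blast
    have "slice G A e ?F \<odot>\<^bsub>?N\<^esub> x = x"
      using smash_of_graded_slice[OF M Idp_closed[OF e(1)] x, of ?F] MC.finite_component[OF x] e(2)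
      by auto
    moreover have "slice G A e ?F \<in> carrier Sm"
      using slice_closed[OF Idp_closed[OF e(1)] MC.finite_component[OF x]] .
    ultimately show "\<exists>f\<in>carrier Sm. f \<odot>\<^bsub>?N\<^esub> x = x" by blast
  qed
qed

lemma smash_of_graded_Obj:
  assumes "M \<in> Obj Gr" shows "smash_of_graded G A \<A> M \<in> Obj SMod"
proof -
  have "normalized_module A M" "is_graded_module G A \<A> M"
    using assms by (simp_all add: graded_module_category_def)
  then show ?thesis
    using smash_of_graded_unital[of M]
    by (auto simp: module_category_def normalized_module_def smash_of_graded_def extensional_def)
qed

lemma graded_of_smash_Obj:
  assumes "N \<in> Obj SMod" shows "graded_of_smash G A \<A> N \<in> Obj Gr"
proof -
  let ?M = "graded_of_smash G A \<A> N"
  have norm: "normalized_module Sm N" and un: "unital_module Sm N"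
    using assms by (simp_all add: module_category_def)
  interpret unital_module Sm N by (rule un)
  interpret smash_module G A \<A> N ..
  have ab: "abelian_group ?M" using abelian_group_same[of ?M N] M.abelian_group_axioms by simp
  interpret M': left_module A ?M
    by (intro left_module.intro A.nonunital_ring_axioms ab left_module_axioms.intro)
      (auto simp: base_smult_closed base_smult_l_distr base_smult_r_distr base_smult_assoc A.m_closed)
  have "unital_module A ?M"
    by (rule M'.unital_moduleI) (use ex_base_unit in auto)
  moreover have "internal_direct_sum ?M (carrier G) (part ?M)"
    using base_part_direct_sum
      internal_direct_sum_cong[of "carrier G" "part ?M" "base_part G A \<A> N" N]
    by (subst internal_direct_sum_same[of ?M N]) simp_all
  moreover have "a \<odot>\<^bsub>?M\<^esub> x \<in> part ?M (\<alpha> \<otimes>\<^bsub>G\<^esub> \<gamma>)"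
    if "\<alpha> \<in> carrier G" "\<gamma> \<in> carrier G" "a \<in> \<A> \<alpha>" "x \<in> part ?M \<gamma>" for \<alpha> \<gamma> a x
  proof -
    have "x \<in> base_part G A \<A> N \<gamma>" "a \<in> carrier A" using that AC.part_carrier by auto
    moreover from this have "x \<in> carrier N" using base_part_carrier by auto
    ultimately show ?thesis using that base_smult_part by simp
  qed
  ultimately have "is_graded_module G A \<A> ?M" by (simp add: is_graded_module_def)
  then show ?thesis
    using norm
    by (auto simp: graded_module_category_def normalized_module_def graded_of_smash_def extensional_def)
qed

section \<open>The two round trips\<close>

lemma graded_of_smash_of_graded:
  assumes "M \<in> Obj Gr" shows "graded_of_smash G A \<A> (smash_of_graded G A \<A> M) = M"
proof -
  let ?N = "smash_of_graded G A \<A> M"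
  have norm: "normalized_module A M" and gm: "is_graded_module G A \<A> M"
    and extP: "part M \<in> extensional (carrier G)"
    using assms by (simp_all add: graded_module_category_def)
  interpret MG: graded_left_module G A \<A> M "part M" by (rule is_graded_moduleD(1)[OF gm])
  interpret U: unital_module Sm ?N by (rule smash_of_graded_unital[OF gm])
  interpret N: smash_module G A \<A> ?N ..
  \<comment> \<open>The degrees of \<open>x\<close> in \<open>M\<close> form a supporting set, and
    \<open>base_smult_eq\<close> permits computing with it.\<close>
  have smult: "base_smult G A \<A> ?N a x = a \<odot>\<^bsub>M\<^esub> x" if a: "a \<in> carrier A" and x: "x \<in> carrier M" for a x
  proof -
    let ?F = "{\<gamma> \<in> carrier G. MG.MC.cmp x \<gamma> \<noteq> \<zero>\<^bsub>M\<^esub>}"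
    have sl: "slice G A b ?F \<odot>\<^bsub>?N\<^esub> x = b \<odot>\<^bsub>M\<^esub> x" if "b \<in> carrier A" for b
      by (rule smash_of_graded_slice[OF gm that x]) (use MG.MC.finite_component[OF x] in auto)
    obtain e where e: "e \<in> Idp" "e \<odot>\<^bsub>M\<^esub> x = x" using ex_graded_unit[OF gm x] by blast
    then have "supports G A \<A> ?N ?F x"
      unfolding supports_def using sl[OF Idp_closed] MG.MC.finite_component[OF x] by auto
    then show ?thesis using N.base_smult_eq[of ?F x a] a x sl[OF a] by simp
  qed
  have part: "base_part G A \<A> ?N \<gamma> = part M \<gamma>" if \<gamma>: "\<gamma> \<in> carrier G" for \<gamma>
  proof -
    \<comment> \<open>\<open>e p_\<gamma>\<close> acts as the projection followed by
      \<open>e\<close>; as \<open>e\<close> has degree \<epsilon>, this stays in degree \<gamma>,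
      which identifies the two gradings.\<close>
    have sl: "slice G A e {\<gamma>} \<odot>\<^bsub>?N\<^esub> x = e \<odot>\<^bsub>M\<^esub> MG.MC.cmp x \<gamma>" if "e \<in> Idp" "x \<in> carrier M" for e x
      using MG.act_slice[of e x "{\<gamma>}"] that \<gamma> Idp_closed MG.MC.component_closed by (simp add: slice_closed)
    show ?thesis
    proof (intro equalityI subsetI)
      fix x assume x: "x \<in> base_part G A \<A> ?N \<gamma>"
      then obtain e where e: "e \<in> Idp" "slice G A e {\<gamma>} \<odot>\<^bsub>?N\<^esub> x = x" by (rule N.ex_base_part_unit)
      have xM: "x \<in> carrier M" using x N.base_part_carrier by auto
      have "e \<odot>\<^bsub>M\<^esub> MG.MC.cmp x \<gamma> \<in> part M (\<one>\<^bsub>G\<^esub> \<otimes>\<^bsub>G\<^esub> \<gamma>)"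
        by (rule MG.smult_part) (use \<gamma> e Idp_part MG.MC.component_part xM in auto)
      then show "x \<in> part M \<gamma>" using sl[OF e(1) xM] e(2) \<gamma> by simp
    next
      fix x assume x: "x \<in> part M \<gamma>"
      have xM: "x \<in> carrier M" using x MG.MC.part_carrier \<gamma> by blast
      obtain e where e: "e \<in> Idp" "e \<odot>\<^bsub>M\<^esub> x = x" using ex_graded_unit[OF gm xM] by blast
      have "slice G A e {\<gamma>} \<odot>\<^bsub>?N\<^esub> x = x"
        using sl[OF e(1) xM] e(2) MG.MC.component_homogeneous[OF \<gamma> x \<gamma>] by simp
      then show "x \<in> base_part G A \<A> ?N \<gamma>" using N.base_partI[OF _ \<gamma> e(1)] xM by simp
    qed
  qed
  have "smult (graded_of_smash G A \<A> ?N) = smult M"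
  proof (intro ext)
    \<comment> \<open>Off the carriers both scalar multiplications are \<open>undefined\<close>, so
      they agree as total functions.\<close>
    fix a x
    have "a \<odot>\<^bsub>M\<^esub> x = undefined" if "\<not> (a \<in> carrier A \<and> x \<in> carrier M)"
      using norm that by (auto simp: normalized_module_def extensional_def)
    then show "a \<odot>\<^bsub>graded_of_smash G A \<A> ?N\<^esub> x = a \<odot>\<^bsub>M\<^esub> x"
      using smult by (simp add: graded_of_smash_def)
  qed
  moreover have "part (graded_of_smash G A \<A> ?N) = part M"
  proof
    fix \<gamma> show "part (graded_of_smash G A \<A> ?N) \<gamma> = part M \<gamma>"
      using part extensional_arb[OF extP] by (cases "\<gamma> \<in> carrier G") simp_all
  qed
  moreover have "mult (graded_of_smash G A \<A> ?N) = mult M" "one (graded_of_smash G A \<A> ?N) = one M"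
    using norm by (simp_all add: normalized_module_def graded_of_smash_def)
  ultimately show ?thesis by (intro graded_module.equality) simp_all
qed

lemma smash_of_graded_of_smash:
  assumes "N \<in> Obj SMod" shows "smash_of_graded G A \<A> (graded_of_smash G A \<A> N) = N"
proof -
  let ?M = "graded_of_smash G A \<A> N"
  have norm: "normalized_module Sm N" and un: "unital_module Sm N"
    using assms by (simp_all add: module_category_def)
  interpret unital_module Sm N by (rule un)
  interpret smash_module G A \<A> N ..
  interpret D: graded_group G N "base_part G A \<A> N"
    by unfold_locales (rule base_part_direct_sum)
  have cmp: "component G ?M (part ?M) = D.cmp"
    by (subst component_same[of ?M N]) (auto intro: component_cong)
  have "smult (smash_of_graded G A \<A> ?M) = smult N"
  proof (intro ext)
    fix f x
    have "f \<odot>\<^bsub>N\<^esub> x = undefined" if "\<not> (f \<in> carrier Sm \<and> x \<in> carrier N)"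
      using norm that by (auto simp: normalized_module_def extensional_def)
    moreover have "smash_act G A ?M (part ?M) f x = f \<odot>\<^bsub>N\<^esub> x" if f: "f \<in> carrier Sm" and x: "x \<in> carrier N"
    proof -
      have "smash_act G A ?M (part ?M) f x = (\<Oplus>\<^bsub>N\<^esub>\<gamma>\<in>{\<gamma> \<in> carrier G. f \<gamma> \<noteq> \<zero>\<^bsub>A\<^esub>}.
          f \<gamma> \<odot>\<^bsub>?M\<^esub> D.cmp x \<gamma>)"
        unfolding smash_act_def cmp by (simp add: finsum_same[of ?M N])
      also have "\<dots> = (\<Oplus>\<^bsub>N\<^esub>\<gamma>\<in>{\<gamma> \<in> carrier G. f \<gamma> \<noteq> \<zero>\<^bsub>A\<^esub>}.
          base_smult G A \<A> N (f \<gamma>) (D.cmp x \<gamma>))"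
        by (rule M.finsum_cong') (use x smash_value[OF f] D.component_closed[OF x] base_smult_closed in auto)
      finally show ?thesis using smash_act_base[OF f x] by simp
    qed
    ultimately show "f \<odot>\<^bsub>smash_of_graded G A \<A> ?M\<^esub> x = f \<odot>\<^bsub>N\<^esub> x"
      by (simp add: smash_of_graded_def)
  qed
  moreover have "mult (smash_of_graded G A \<A> ?M) = mult N" "one (smash_of_graded G A \<A> ?M) = one N"
    using norm by (simp_all add: normalized_module_def smash_of_graded_def)
  ultimately show ?thesis by (intro module.equality) simp_all
qed

text \<open>A graded map keeps the degree \<gamma> of a homogeneous element, so \<open>f\<close>
  acts on the element and on its image by the same scalar \<open>f \<gamma>\<close>, which
  \<open>h\<close> respects; additivity does the rest.\<close>

lemma smash_of_graded_Hom:
  assumes "L \<in> Obj Gr" "M \<in> Obj Gr" "h \<in> Hom Gr L M"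
  shows "h \<in> Hom SMod (smash_of_graded G A \<A> L) (smash_of_graded G A \<A> M)"
proof -
  interpret L: graded_left_module G A \<A> L "part L"
    by (rule is_graded_moduleD(1)) (use assms(1) in \<open>simp add: graded_module_category_def\<close>)
  interpret M: graded_left_module G A \<A> M "part M"
    by (rule is_graded_moduleD(1)) (use assms(2) in \<open>simp add: graded_module_category_def\<close>)
  have h: "h \<in> carrier L \<rightarrow>\<^sub>E carrier M"
    "\<And>x y. x \<in> carrier L \<Longrightarrow> y \<in> carrier L \<Longrightarrow> h (x \<oplus>\<^bsub>L\<^esub> y) = h x \<oplus>\<^bsub>M\<^esub> h y"
    "\<And>a x. a \<in> carrier A \<Longrightarrow> x \<in> carrier L \<Longrightarrow> h (a \<odot>\<^bsub>L\<^esub> x) = a \<odot>\<^bsub>M\<^esub> h x"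
    "\<And>\<gamma>. \<gamma> \<in> carrier G \<Longrightarrow> h ` part L \<gamma> \<subseteq> part M \<gamma>"
    using assms(3) by (auto simp: graded_module_category_def linear_maps_def)
  have hM: "h x \<in> carrier M" if "x \<in> carrier L" for x using h(1) that by auto
  have act: "h (L.act f x) = M.act f (h x)" if f: "f \<in> carrier Sm" and x: "x \<in> carrier L" for f x
    using x
  proof (induction x rule: L.MC.homogeneous_induct)
    case (homogeneous \<gamma> x)
    moreover have "x \<in> carrier L" using homogeneous L.MC.part_carrier by blast
    moreover have "h x \<in> part M \<gamma>" using homogeneous h(4) by blast
    ultimately show ?case
      using h(3) smash_value[OF f] by (simp add: L.act_homogeneous[OF f] M.act_homogeneous[OF f])
  next
    case (add x y)
    then show ?case using f hM by (simp add: L.act_add_right M.act_add_right L.act_closed h(2))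
  next
    show "carrier G \<noteq> {}" using G.one_closed by blast
  qed
  show ?thesis using h(1,2) act hM by (simp add: module_category_def linear_maps_def)
qed

text \<open>\<open>supports\<close> is expressed by the action of the smash product, hence preserved
  by its linear maps. Both the parts and the recovered scalar multiplication are defined through
  it.\<close>

lemma graded_of_smash_Hom:
  assumes "L \<in> Obj SMod" "M \<in> Obj SMod" "h \<in> Hom SMod L M"
  shows "h \<in> Hom Gr (graded_of_smash G A \<A> L) (graded_of_smash G A \<A> M)"
proof -
  interpret UL: unital_module Sm L using assms(1) by (simp add: module_category_def)
  interpret L: smash_module G A \<A> L ..
  interpret UM: unital_module Sm M using assms(2) by (simp add: module_category_def)
  interpret M: smash_module G A \<A> M ..
  have h: "h \<in> carrier L \<rightarrow>\<^sub>E carrier M"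
    "\<And>x y. x \<in> carrier L \<Longrightarrow> y \<in> carrier L \<Longrightarrow> h (x \<oplus>\<^bsub>L\<^esub> y) = h x \<oplus>\<^bsub>M\<^esub> h y"
    "\<And>f x. f \<in> carrier Sm \<Longrightarrow> x \<in> carrier L \<Longrightarrow> h (f \<odot>\<^bsub>L\<^esub> x) = f \<odot>\<^bsub>M\<^esub> h x"
    using assms(3) by (auto simp: module_category_def linear_maps_def)
  have hM: "h x \<in> carrier M" if "x \<in> carrier L" for x using h(1) that by auto
  have sup: "supports G A \<A> M F (h x)" if F: "supports G A \<A> L F x" and x: "x \<in> carrier L" for F x
  proof -
    obtain e where e: "finite F" "F \<subseteq> carrier G" "e \<in> Idp" "slice G A e F \<odot>\<^bsub>L\<^esub> x = x"
      using F by (auto simp: supports_def)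
    then have "slice G A e F \<odot>\<^bsub>M\<^esub> h x = h x"
      using h(3)[OF slice_closed[OF Idp_closed[OF e(3)] e(1)] x] by simp
    then show ?thesis using e by (auto simp: supports_def)
  qed
  have smult: "h (base_smult G A \<A> L a x) = base_smult G A \<A> M a (h x)"
    if a: "a \<in> carrier A" and x: "x \<in> carrier L" for a x
  proof -
    obtain F where F: "supports G A \<A> L F x" using L.ex_supports[OF x] by blast
    then have "finite F" by (simp add: supports_def)
    then show ?thesis
      using L.base_smult_eq[OF F x a] M.base_smult_eq[OF sup[OF F x] hM[OF x] a] h(3) x a
      by (simp add: slice_closed)
  qed
  have "h ` base_part G A \<A> L \<gamma> \<subseteq> base_part G A \<A> M \<gamma>" for \<gamma>
    using sup hM by (auto simp: base_part_def)
  then show ?thesis using h(1,2) smult hM by (simp add: graded_module_category_def linear_maps_def)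
qed

definition "smash_functor = \<lparr>fob = smash_of_graded G A \<A>, fmor = (\<lambda>L M f. f)\<rparr>"
definition "graded_functor = \<lparr>fob = graded_of_smash G A \<A>, fmor = (\<lambda>L M f. f)\<rparr>"

lemma smash_functor_iso: "category_iso Gr SMod smash_functor"
  unfolding category_iso_def
proof (intro conjI exI)
  show "is_functor Gr SMod smash_functor"
    unfolding is_functor_def
  proof (intro conjI ballI category_module_category category_graded_module_category)
    fix L assume "L \<in> Obj Gr"
    then show "fob smash_functor L \<in> Obj SMod"
      by (simp add: smash_functor_def smash_of_graded_Obj)
  next
    fix L M h assume "L \<in> Obj Gr" "M \<in> Obj Gr" "h \<in> Hom Gr L M"
    then show "fmor smash_functor L M h \<in> Hom SMod (fob smash_functor L) (fob smash_functor M)"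
      by (simp add: smash_functor_def smash_of_graded_Hom)
  qed (simp_all add: smash_functor_def module_category_def graded_module_category_def)
  show "is_functor SMod Gr graded_functor"
    unfolding is_functor_def
  proof (intro conjI ballI category_module_category category_graded_module_category)
    fix L assume "L \<in> Obj SMod"
    then show "fob graded_functor L \<in> Obj Gr"
      by (simp add: graded_functor_def graded_of_smash_Obj)
  next
    fix L M h assume "L \<in> Obj SMod" "M \<in> Obj SMod" "h \<in> Hom SMod L M"
    then show "fmor graded_functor L M h \<in> Hom Gr (fob graded_functor L) (fob graded_functor M)"
      by (simp add: graded_functor_def graded_of_smash_Hom)
  qed (simp_all add: graded_functor_def module_category_def graded_module_category_def)
  show "functor_eq Gr (functor_comp graded_functor smash_functor) functor_id"
    by (simp add: functor_eq_def functor_comp_def functor_id_def graded_functor_def smash_functor_def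
        graded_of_smash_of_graded)
  show "functor_eq SMod (functor_comp smash_functor graded_functor) functor_id"
    by (simp add: functor_eq_def functor_comp_def functor_id_def graded_functor_def smash_functor_def
        smash_of_graded_of_smash)
qed

section \<open>Compatibility with the shifts\<close>

lemma smash_shift_closed:
  assumes f: "f \<in> carrier Sm" and \<alpha>: "\<alpha> \<in> carrier G"
  shows "smash_shift G \<alpha> f \<in> carrier Sm"
proof -
  have "{\<gamma> \<in> carrier G. smash_shift G \<alpha> f \<gamma> \<noteq> \<zero>\<^bsub>A\<^esub>}
      \<subseteq> (\<lambda>\<gamma>. \<gamma> \<otimes>\<^bsub>G\<^esub> \<alpha>) ` {\<gamma> \<in> carrier G. f \<gamma> \<noteq> \<zero>\<^bsub>A\<^esub>}"
  proof
    fix \<gamma> assume "\<gamma> \<in> {\<gamma> \<in> carrier G. smash_shift G \<alpha> f \<gamma> \<noteq> \<zero>\<^bsub>A\<^esub>}"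
    then have \<gamma>: "\<gamma> \<in> carrier G" "f (\<gamma> \<otimes>\<^bsub>G\<^esub> inv\<^bsub>G\<^esub> \<alpha>) \<noteq> \<zero>\<^bsub>A\<^esub>"
      by (auto simp: smash_shift_def)
    have "\<gamma> = (\<gamma> \<otimes>\<^bsub>G\<^esub> inv\<^bsub>G\<^esub> \<alpha>) \<otimes>\<^bsub>G\<^esub> \<alpha>" using \<gamma> \<alpha> by (simp add: G.m_assoc)
    then show "\<gamma> \<in> (\<lambda>\<gamma>. \<gamma> \<otimes>\<^bsub>G\<^esub> \<alpha>) ` {\<gamma> \<in> carrier G. f \<gamma> \<noteq> \<zero>\<^bsub>A\<^esub>}"
      by (rule image_eqI) (use \<gamma> \<alpha> in auto)
  qed
  then have "finite {\<gamma> \<in> carrier G. smash_shift G \<alpha> f \<gamma> \<noteq> \<zero>\<^bsub>A\<^esub>}"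
    by (rule finite_subset) (use smash_finite[OF f] in simp)
  then show ?thesis using smash_value[OF f] \<alpha> by (simp add: smash_carrier smash_shift_def)
qed

lemma graded_shift_graded_left_module:
  assumes "graded_left_module G A \<A> M P" and \<alpha>: "\<alpha> \<in> carrier G"
    and P': "\<And>\<gamma>. \<gamma> \<in> carrier G \<Longrightarrow> P' \<gamma> = P (\<gamma> \<otimes>\<^bsub>G\<^esub> \<alpha>)"
  shows "graded_left_module G A \<A> M P'"
proof -
  interpret graded_left_module G A \<A> M P by fact
  show ?thesis
    by unfold_locales
      (use MC.graded_group_shift(1)[OF G.group_axioms \<alpha> P'] smult_part P' \<alpha> in \<open>auto simp: G.m_assoc\<close>)
qed

text \<open>An element of degree \<gamma> for \<open>P\<close> has degree \<gamma>\<alpha>^{-1} for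
  \<open>P'\<close>. So the left side multiplies it by the value of \<open>f\<close> there, which is
  the coefficient of the shifted \<open>f\<close> at \<gamma>.\<close>

lemma smash_act_shift:
  assumes "graded_left_module G A \<A> M P" and \<alpha>: "\<alpha> \<in> carrier G"
    and P': "\<And>\<gamma>. \<gamma> \<in> carrier G \<Longrightarrow> P' \<gamma> = P (\<gamma> \<otimes>\<^bsub>G\<^esub> \<alpha>)"
    and f: "f \<in> carrier Sm" and x: "x \<in> carrier M"
  shows "smash_act G A M P' f x = smash_act G A M P (smash_shift G \<alpha> f) x"
proof -
  interpret graded_left_module G A \<A> M P by fact
  interpret S: graded_left_module G A \<A> M P'
    by (rule graded_shift_graded_left_module[OF assms(1-3)])
  note sf = smash_shift_closed[OF f \<alpha>]
  show ?thesis using x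
  proof (induction x rule: MC.homogeneous_induct)
    case (homogeneous \<gamma> x)
    let ?\<delta> = "\<gamma> \<otimes>\<^bsub>G\<^esub> inv\<^bsub>G\<^esub> \<alpha>"
    have \<delta>: "?\<delta> \<in> carrier G" "x \<in> P' ?\<delta>"
      using homogeneous \<alpha> P'[of ?\<delta>] by (auto simp: G.m_assoc)
    have "smash_shift G \<alpha> f \<gamma> = f ?\<delta>" using homogeneous(1) by (simp add: smash_shift_def)
    then show ?case
      using S.act_homogeneous[OF f \<delta>] act_homogeneous[OF sf homogeneous] by simp
  next
    case (add x y)
    then show ?case using f sf by (simp add: act_add_right S.act_add_right)
  next
    show "carrier G \<noteq> {}" using G.one_closed by blast
  qed
qed

lemma smash_functor_shift:
  assumes \<alpha>: "\<alpha> \<in> carrier G"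
  shows "functor_eq (Gr :: (('a, 'm, 'g) graded_module, 'm \<Rightarrow> 'm) cat)
    (functor_comp smash_functor (graded_shift G \<alpha>))
    (functor_comp (smash_module_shift G A \<A> \<alpha>) smash_functor)"
proof -
  have "smash_of_graded G A \<A> (fob (graded_shift G \<alpha>) M)
      = fob (smash_module_shift G A \<A> \<alpha>) (smash_of_graded G A \<A> M)" if M: "M \<in> Obj Gr"
    for M :: "('a, 'm, 'g) graded_module"
  proof -
    let ?P = "\<lambda>\<gamma>\<in>carrier G. part M (\<gamma> \<otimes>\<^bsub>G\<^esub> \<alpha>)"
    have "graded_left_module G A \<A> M (part M)"
      by (rule is_graded_moduleD(1)) (use M in \<open>simp add: graded_module_category_def\<close>)
    then have act: "smash_act G A M ?P f x = smash_act G A M (part M) (smash_shift G \<alpha> f) x"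
      if "f \<in> carrier Sm" "x \<in> carrier M" for f x
      by (rule smash_act_shift[OF _ \<alpha>]) (use that in auto)
    let ?M = "M\<lparr>part := ?P\<rparr>"
    \<comment> \<open>Replacing \<open>part\<close> changes neither the additive group nor the
      scalars, and besides the explicit grading the action uses nothing else of the module.\<close>
    have "smash_act G A ?M ?P = smash_act G A M ?P"
      by (intro ext) (simp add: smash_act_def finsum_same[of ?M M] component_same[of ?M M])
    then show ?thesis
      using act smash_shift_closed[OF _ \<alpha>]
      by (auto simp: smash_of_graded_def graded_shift_def smash_module_shift_def fun_eq_iff)
  qed
  \<comment> \<open>All functors involved leave morphisms unchanged, so only the objects had to be
    compared.\<close>
  then show ?thesis
    by (simp add: functor_eq_def functor_comp_def smash_functor_def graded_shift_def smash_module_shift_def)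
qed

end

theorem proposition2p5:
  fixes G :: "('g, 'x) monoid_scheme"
    and A :: "('a, 'y) ring_scheme"
    and \<A> :: "'g \<Rightarrow> 'a set"
  assumes "group G"
    and "graded_ring G A \<A>"
    and "graded_local_units G A \<A>"
  shows "\<exists>\<Psi> :: (('a, 'm, 'g) graded_module, 'm \<Rightarrow> 'm, ('g \<Rightarrow> 'a, 'm) module, 'm \<Rightarrow> 'm) func.
    category_iso (graded_module_category G A \<A>) (module_category (smash_product G A \<A>)) \<Psi> \<and>
    (\<forall>\<alpha>\<in>carrier G.
      functor_eq (graded_module_category G A \<A>)
        (functor_comp \<Psi> (graded_shift G \<alpha>))
        (functor_comp (smash_module_shift G A \<A> \<alpha>) \<Psi>))"
proof -
  interpret locally_unital_graded_ring G A \<A>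
    using assms by (simp add: locally_unital_graded_ring_def locally_unital_graded_ring_axioms_def)
  show ?thesis using smash_functor_iso smash_functor_shift by blast
qed

end
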